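(* Let $m\ge2$ and let $S^m\subset\mathbb{R}^{m+1}$ be the unit sphere. Set $$p^{(0)}=(\underbrace{1,\ldots,1}_{m},0),\quad p^{(1)}=(0,\underbrace{1,\ldots,1}_{m-1},1/2),\quad p^{(2)}=(0,0,\underbrace{1,\ldots,1}_{m-1})$$ in $\mathbb{R}^{m+1}$, and let $P$ be the convex hull of $\{p^{(0)},p^{(1)},p^{(2)}\}$. Then $S^m$ is uniformly profile-regular, with $$\rho_{S^m}(a)=\max\Bigl\{\sum_{i=1}^m a_i,\ \tfrac12a_{m+1}+\sum_{i=2}^m a_i,\ a_{m+1}+\sum_{i=3}^m a_i\Bigr\},\qquad a\in\mathcal K_{m+1}.$$ Its lower and upper prints are $$\underline{\mathrm P}(S^m)=\{\alpha\in[0,\infty)^{m+1}:\ \text{there exists }p\in P\text{ such that }S_k(\alpha)\le S_k(p)\ (1\le k\le m+1)\}$$ and $$\overline{\mathrm P}(S^m)=\{\alpha\in[0,\infty)^{m+1}:S_1(\alpha)\le m\}\cup\{\alpha\in[0,\infty)^{m+1}:S_2(\alpha)<m-\tfrac12\}\cup\bigcup_{k=3}^{m+1}\{\alpha\in[0,\infty)^{m+1}:S_k(\alpha)<m-k+2\}.$$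
   Context: $S_k(\gamma)=\sum_{i=k}^{n}\gamma_i$ for $\gamma\in\mathbb{R}^n$; here $n=m+1$. An open box in $\mathbb{R}^n$ is an open rectangular box with positive side lengths and arbitrary orientation; its side lengths in decreasing order are $l_1(B)\ge\cdots\ge l_n(B)>0$. Let $\Delta_n=\{\delta\in(0,1)^n:\delta_1\ge\cdots\ge\delta_n\}$. For non-empty bounded $F\subset\mathbb{R}^n$ and $\delta\in\Delta_n$, $N(F;\delta)$ is the least number of open boxes $B$ needed to cover $F$, subject to $l_i(B)\le\delta_i$ for $1\le i\le n$ for every box in the cover (boxes may have different orientations). For $\alpha\in[0,\infty)^n$ write $\delta^\alpha=\prod_i\delta_i^{\alpha_i}$. The lower and upper box dimension prints are $$\underline{\mathrm P}(F)=\Bigl\{\alpha\in[0,\infty)^n:\liminf_{\delta\in\Delta_n,\,\delta_1\downarrow0}N(F;\delta)\delta^\alpha>0\Bigr\},\quad \overline{\mathrm P}(F)=\Bigl\{\alpha\in[0,\infty)^n:\limsup_{\delta\in\Delta_n,\,\delta_1\downarrow0}N(F;\delta)\delta^\alpha>0\Bigr\},$$ the limits being over all of $\Delta_n$ as $\delta_1\downarrow0$. Let $\mathcal K_n=\{a\in(0,\infty)^n:a_1\le\cdots\le a_n\}$ and $\mathcal C_n=\{a\in\mathcal K_n:a_1=1\}$. For $a\in\mathcal K_n$, $t>0$ let $e^{-ta}=(e^{-ta_1},\dots,e^{-ta_n})$. The profile of $F$ exists if for every $a\in\mathcal K_n$ the limit $\rho_F(a)=\lim_{t\to\infty}\frac1t\log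 N(F;e^{-ta})$ exists. $F$ is uniformly profile-regular if its profile exists and there are $C\ge1$ and $t_0>0$ such that $C^{-1}e^{t\rho_F(a)}\le N(F;e^{-ta})\le Ce^{t\rho_F(a)}$ for all $a\in\mathcal C_n$, $t\ge t_0$. *)

theory Defs
  imports "HOL-Analysis.Analysis"
begin

section \<open>Numbered coordinates\<close>

text \<open>
  Euclidean \<open>n\<close>-space is \<^typ>\<open>real ^ 'n\<close> with \<open>n = CARD('n)\<close>, where \<open>'n\<close> is linearly
  ordered so that "first" and "last" coordinates make sense. \<open>pos\<close> is the order isomorphism
  from the index type onto \<open>{1..n}\<close>; \<open>coord x k\<close> is the \<open>k\<close>-th coordinate, counted from 1, and is
  meaningful for \<open>1 \<le> k \<le> n\<close> only.
\<close>

definition pos :: "'n::{finite,linorder} \<Rightarrow> nat"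
  where "pos i = card {..i}"

definition coord :: "real ^ 'n::{finite,linorder} \<Rightarrow> nat \<Rightarrow> real"
  where "coord x k = x $ (inv pos k)"

definition vec_of :: "(nat \<Rightarrow> real) \<Rightarrow> real ^ 'n::{finite,linorder}"
  where "vec_of f = (\<chi> i. f (pos i))"

lemma strict_mono_pos: "strict_mono (pos :: 'n::{finite,linorder} \<Rightarrow> nat)"
  unfolding pos_def by (intro strict_monoI psubset_card_mono) auto

lemma bij_betw_pos: "bij_betw pos (UNIV :: 'n::{finite,linorder} set) {1..CARD('n)}"
proof -
  have inj: "inj (pos :: 'n \<Rightarrow> nat)"
    by (rule strict_mono_imp_inj_on[OF strict_mono_pos])
  have "range (pos :: 'n \<Rightarrow> nat) \<subseteq> {1..CARD('n)}"
    by (auto simp: pos_def Suc_le_eq card_gt_0_iff intro!: card_mono)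
  moreover have "card (range (pos :: 'n \<Rightarrow> nat)) = card {1..CARD('n)}"
    using inj by (simp add: card_image)
  ultimately have "range (pos :: 'n \<Rightarrow> nat) = {1..CARD('n)}"
    by (intro card_subset_eq) simp_all
  with inj show ?thesis
    by (simp add: bij_betw_def)
qed

lemma coord_pos [simp]: "coord x (pos i) = x $ i"
  by (simp add: coord_def inv_f_f strict_mono_imp_inj_on strict_mono_pos)

lemma coord_vec_of:
  "k \<in> {1..CARD('n)} \<Longrightarrow> coord (vec_of f :: real ^ 'n::{finite,linorder}) k = f k"
  using bij_betw_pos[where 'n = 'n]
  by (auto simp: coord_def vec_of_def bij_betw_def f_inv_into_f)

definition tail_sum :: "nat \<Rightarrow> real ^ 'n::{finite,linorder} \<Rightarrow> real"
  where "tail_sum k \<gamma> = (\<Sum>i = k..CARD('n). coord \<gamma> i)"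

definition orthant :: "(real ^ 'n) set"
  where "orthant = {\<alpha>. \<forall>i. 0 \<le> \<alpha> $ i}"


section \<open>Covering numbers by boxes\<close>

text \<open>
  \<open>open_box_with_sides B l\<close>: \<open>B\<close> is an open rectangular box, in any orientation, whose side
  lengths in decreasing order are the entries of \<open>l\<close>. Coordinate permutations are orthogonal
  transformations, so requiring \<open>l\<close> to be decreasing excludes no box.
\<close>

definition open_box_with_sides :: "(real ^ 'n::{finite,linorder}) set \<Rightarrow> real ^ 'n::{finite,linorder} \<Rightarrow> bool"
  where "open_box_with_sides B l \<longleftrightarrow>
    (\<forall>i. 0 < l $ i) \<and> (\<forall>i j. i \<le> j \<longrightarrow> l $ j \<le> l $ i) \<and>
    (\<exists>f c. orthogonal_transformation f \<and> B = (\<lambda>x. c + f x) ` box 0 l)"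

definition admissible_scales :: "(real ^ 'n::{finite,linorder}) set"
  where "admissible_scales =
    {\<delta>. (\<forall>i. 0 < \<delta> $ i \<and> \<delta> $ i < 1) \<and> (\<forall>i j. i \<le> j \<longrightarrow> \<delta> $ j \<le> \<delta> $ i)}"

definition cover_number :: "(real ^ 'n::{finite,linorder}) set \<Rightarrow> real ^ 'n::{finite,linorder} \<Rightarrow> nat"
  where "cover_number F \<delta> =
    (LEAST k. \<exists>\<B>. finite \<B> \<and> card \<B> = k \<and> F \<subseteq> \<Union>\<B> \<and>
      (\<forall>B\<in>\<B>. \<exists>l. open_box_with_sides B l \<and> (\<forall>i. l $ i \<le> \<delta> $ i)))"


section \<open>Box dimension prints\<close>

definition vpow :: "real ^ 'n \<Rightarrow> real ^ 'n \<Rightarrow> real"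
  where "vpow \<delta> \<alpha> = (\<Prod>i\<in>UNIV. (\<delta> $ i) powr (\<alpha> $ i))"

text \<open>The filter of the limits over all admissible \<open>\<delta>\<close> as the largest entry tends to 0.\<close>

definition scales_to_0 :: "(real ^ 'n::{finite,linorder}) filter"
  where "scales_to_0 =
    inf (filtercomap (\<lambda>\<delta>. coord \<delta> 1) (at_right 0)) (principal admissible_scales)"

definition lower_print :: "(real ^ 'n::{finite,linorder}) set \<Rightarrow> (real ^ 'n::{finite,linorder}) set"
  where "lower_print F =
    {\<alpha> \<in> orthant. Liminf scales_to_0 (\<lambda>\<delta>. ereal (real (cover_number F \<delta>) * vpow \<delta> \<alpha>)) > 0}"

definition upper_print :: "(real ^ 'n::{finite,linorder}) set \<Rightarrow> (real ^ 'n::{finite,linorder}) set"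
  where "upper_print F =
    {\<alpha> \<in> orthant. Limsup scales_to_0 (\<lambda>\<delta>. ereal (real (cover_number F \<delta>) * vpow \<delta> \<alpha>)) > 0}"


section \<open>Profiles\<close>

definition rate_cone :: "(real ^ 'n::{finite,linorder}) set"
  where "rate_cone = {a. (\<forall>i. 0 < a $ i) \<and> (\<forall>i j. i \<le> j \<longrightarrow> a $ i \<le> a $ j)}"

definition normalized_rates :: "(real ^ 'n::{finite,linorder}) set"
  where "normalized_rates = {a \<in> rate_cone. coord a 1 = 1}"

definition exp_scale :: "real \<Rightarrow> real ^ 'n \<Rightarrow> real ^ 'n"
  where "exp_scale t a = (\<chi> i. exp (- t * a $ i))"

definition profile_exists :: "(real ^ 'n::{finite,linorder}) set \<Rightarrow> bool"
  where "profile_exists F \<longleftrightarrow>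
    (\<forall>a\<in>rate_cone. \<exists>L. ((\<lambda>t. 1 / t * ln (real (cover_number F (exp_scale t a)))) \<longlongrightarrow> L) at_top)"

text \<open>The value of \<open>profile\<close> is meaningful only where the limit exists.\<close>

definition profile :: "(real ^ 'n::{finite,linorder}) set \<Rightarrow> real ^ 'n::{finite,linorder} \<Rightarrow> real"
  where "profile F a = Lim at_top (\<lambda>t. 1 / t * ln (real (cover_number F (exp_scale t a))))"

definition uniformly_profile_regular :: "(real ^ 'n::{finite,linorder}) set \<Rightarrow> bool"
  where "uniformly_profile_regular F \<longleftrightarrow> profile_exists F \<and>
    (\<exists>C\<ge>1. \<exists>t\<^sub>0>0. \<forall>a\<in>normalized_rates. \<forall>t\<ge>t\<^sub>0.
      inverse C * exp (t * profile F a) \<le> real (cover_number F (exp_scale t a)) \<and>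
      real (cover_number F (exp_scale t a)) \<le> C * exp (t * profile F a))"

end

theory Submission
  imports Defs
begin

text \<open>
  Everything follows from one two-sided estimate, uniform over all admissible scales \<open>\<delta>\<close>
  (\<open>cover_number_sphere_bounds\<close>): up to constants depending on the dimension only, \<open>N(S; \<delta>)\<close> is the
  maximum of the three monomials \<open>\<delta>\<^sup>-\<^sup>p\<close>, where \<open>p\<close> runs through \<open>p0\<close>, \<open>p1\<close>, \<open>p2\<close>.

  For the upper bound the sphere is covered by rotated copies of a thin patch around a pole, whose
  tangential sides are \<open>\<delta>\<^sub>2, \<dots>, \<delta>\<^sub>m\<close> and one side \<open>w\<close> at least as long; the patch is then cut, in
  the normal direction, into slices of thickness \<open>\<delta>\<^sub>m\<^sub>+\<^sub>1\<close>. The best \<open>w\<close> between \<open>\<delta>\<^sub>2\<close> and \<open>\<delta>\<^sub>1\<close> is the one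
  closest to the square root of \<open>\<delta>\<^sub>m\<^sub>+\<^sub>1\<close>, below which curvature is invisible at the scale \<open>\<delta>\<^sub>m\<^sub>+\<^sub>1\<close>. The
  copies come from composing rotations in coordinate planes (\<open>rotations_to_axis\<close>).

  For the lower bound the boxes of a cover are enlarged so that they cover the shell between the
  spheres of radius 1 and \<open>1 + \<delta>\<^sub>m\<^sub>+\<^sub>1\<close>, and volumes are compared. If all coordinates of a box but the
  first two are fixed, the shell cuts out a plane annulus whose radii squared differ by \<open>O(\<delta>\<^sub>m\<^sub>+\<^sub>1)\<close>.
  Its area inside a rectangle with sides \<open>\<delta>\<^sub>1\<close>, \<open>\<delta>\<^sub>2\<close> is bounded, up to a constant, by \<open>\<delta>\<^sub>1 \<delta>\<^sub>2\<close>, by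
  \<open>\<delta>\<^sub>2\<close> times the square root of \<open>\<delta>\<^sub>m\<^sub>+\<^sub>1\<close>, and by \<open>\<delta>\<^sub>m\<^sub>+\<^sub>1\<close> (\<open>nn_integral_annulus_section_le\<close>). These are
  the three monomials.

  The rest is convex geometry and holds for any set whose covering numbers are comparable to a
  maximum of finitely many monomials (\<open>cover_comparable\<close>). With \<open>\<delta> = exp (- a)\<close> the logarithm of
  \<open>N(S; \<delta>) \<delta>\<^sup>\<alpha>\<close> is, up to a bounded error, the maximum of the numbers \<open>a \<bullet> (p - \<alpha>)\<close>. Its
  value for \<open>\<alpha> = 0\<close> is the profile. The lower print asks the maximum to be nonnegative for all
  increasing positive \<open>a\<close>; by separation of convex sets, this happens exactly if some point of the
  convex hull dominates \<open>\<alpha>\<close> in all tail sums (\<open>majorized_by_hull_iff\<close>). The upper print asks the maximum not to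
  tend to minus infinity as the smallest entry of \<open>a\<close> grows, which Abel summation turns into conditions
  on single tail sums (\<open>cover_comparable_upper_print\<close>).
\<close>

section \<open>Coordinates and tail sums\<close>
lemma pos_ge_1: "1 \<le> pos (i::'n::{finite,linorder})"
  using bij_betw_pos[where 'n='n] by (auto simp: bij_betw_def)

lemma pos_le_card: "pos (i::'n::{finite,linorder}) \<le> CARD('n)"
  using bij_betw_pos[where 'n='n] by (auto simp: bij_betw_def)

lemma pos_le_iff: "pos i \<le> pos j \<longleftrightarrow> i \<le> (j::'n::{finite,linorder})"
  by (rule strict_mono_less_eq[OF strict_mono_pos])

lemma pos_eq_iff: "pos i = pos j \<longleftrightarrow> i = (j::'n::{finite,linorder})"
  by (rule strict_mono_eq[OF strict_mono_pos])

lemma pos_surj: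
  assumes "k \<in> {1..CARD('n)}"
  obtains i :: "'n::{finite,linorder}" where "pos i = k"
proof -
  have "k \<in> range (pos :: 'n \<Rightarrow> nat)"
    using assms bij_betw_pos[where 'n='n] by (simp add: bij_betw_def)
  then show ?thesis using that by auto
qed

lemma sum_pos:
  fixes g :: "nat \<Rightarrow> real"
  shows "(\<Sum>i\<in>(UNIV::'n::{finite,linorder} set). g (pos i)) = sum g {1..CARD('n)}"
  using sum.reindex_bij_betw[OF bij_betw_pos[where 'n='n], of g] .

lemma tail_sum_eq_sum_pos:
  fixes \<gamma> :: "real ^ 'n::{finite,linorder}"
  assumes "k \<ge> 1"
  shows "tail_sum k \<gamma> = (\<Sum>i\<in>UNIV. (if k \<le> pos i then 1 else 0) * \<gamma> $ i)"
proof -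
  have "tail_sum k \<gamma> = (\<Sum>j = 1..CARD('n). (if k \<le> j then 1 else 0) * coord \<gamma> j)"
    unfolding tail_sum_def using assms by (intro sum.mono_neutral_cong_left) auto
  also have "\<dots> = (\<Sum>i\<in>(UNIV::'n set). (if k \<le> pos i then 1 else 0) * coord \<gamma> (pos i))"
    by (rule sum_pos[symmetric])
  finally show ?thesis by simp
qed

lemma tail_sum_add: "tail_sum k (x + y) = tail_sum k x + tail_sum k y"
  and tail_sum_diff: "tail_sum k (x - y) = tail_sum k x - tail_sum k y"
  and tail_sum_scaleR: "tail_sum k (c *\<^sub>R x) = c * tail_sum k x"
  by (simp_all add: tail_sum_def coord_def sum.distrib sum_subtractf sum_distrib_left)

lemma tail_sum_conv_inner:
  fixes \<gamma> :: "real ^ 'n::{finite,linorder}"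
  assumes "k \<ge> 1"
  shows "tail_sum k \<gamma> = (\<chi> i. if k \<le> pos i then 1 else 0) \<bullet> \<gamma>"
  by (simp add: tail_sum_eq_sum_pos[OF assms] inner_vec_def)

lemma tail_sum_axis:
  fixes j :: "'n::{finite,linorder}"
  assumes "k \<ge> 1"
  shows "tail_sum k (axis j 1) = (if k \<le> pos j then 1 else 0)"
proof -
  have "tail_sum k (axis j 1) = (\<Sum>i\<in>UNIV. if i = j then if k \<le> pos i then 1 else 0 else 0)"
    unfolding tail_sum_eq_sum_pos[OF assms] by (intro sum.cong) (auto simp: axis_def)
  then show ?thesis by simp
qed

text \<open>
  In terms of the tail sums, a linear form has the increments of its coefficients as weights, and
  these are nonnegative if the coefficients increase. This is how tail sums enter the description of
  the prints.
\<close>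
lemma abel_summation_tail:
  fixes f g :: "nat \<Rightarrow> real"
  assumes "n \<ge> 1"
  shows "(\<Sum>k=1..n. f k * g k) =
    f 1 * (\<Sum>i=1..n. g i) + (\<Sum>k=2..n. (f k - f (k - 1)) * (\<Sum>i=k..n. g i))"
  using assms
proof (induction n rule: dec_induct)
  case base
  then show ?case by simp
next
  case (step n)
  have tel: "(\<Sum>k=2..Suc n. f k - f (k - 1)) = f (Suc n) - f 1"
    using sum_telescope''[of 1 "Suc n" f] step.hyps by (simp add: numeral_2_eq_2 del: sum.cl_ivl_Suc)
  have "(\<Sum>k=2..Suc n. (f k - f (k - 1)) * (\<Sum>i=k..Suc n. g i))
      = (\<Sum>k=2..Suc n. (f k - f (k - 1)) * (\<Sum>i=k..n. g i) + (f k - f (k - 1)) * g (Suc n))"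
    by (intro sum.cong) (auto simp: distrib_left)
  also have "\<dots> = (\<Sum>k=2..Suc n. (f k - f (k - 1)) * (\<Sum>i=k..n. g i)) + (f (Suc n) - f 1) * g (Suc n)"
    unfolding sum.distrib tel[symmetric] sum_distrib_right ..
  also have "(\<Sum>k=2..Suc n. (f k - f (k - 1)) * (\<Sum>i=k..n. g i))
      = (\<Sum>k=2..n. (f k - f (k - 1)) * (\<Sum>i=k..n. g i))"
    using step.hyps by simp
  finally show ?case using step by (simp add: algebra_simps)
qed

lemma rate_cone_pos: "a \<in> rate_cone \<Longrightarrow> 0 < a $ i"
  and rate_cone_mono: "a \<in> rate_cone \<Longrightarrow> i \<le> j \<Longrightarrow> a $ i \<le> a $ j"
  by (auto simp: rate_cone_def)

text \<open>
  By Abel summation every tail sum but the first occurs in \<open>a \<bullet> d\<close> with a nonnegative weight,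
  so the terms with \<open>k \<ge> 2\<close> can be dropped.
\<close>
lemma inner_le_first_mult_tail_sum:
  fixes a d :: "real ^ 'n::{finite,linorder}"
  assumes a: "a \<in> rate_cone" and d: "\<And>k. k \<in> {2..CARD('n)} \<Longrightarrow> tail_sum k d \<le> 0"
  shows "a \<bullet> d \<le> coord a 1 * tail_sum 1 d"
proof -
  have "a \<bullet> d = (\<Sum>i\<in>(UNIV::'n set). coord a (pos i) * coord d (pos i))"
    by (simp add: inner_vec_def)
  also have "\<dots> = (\<Sum>k=1..CARD('n). coord a k * coord d k)"
    by (rule sum_pos)
  also have "\<dots> = coord a 1 * tail_sum 1 d
      + (\<Sum>k=2..CARD('n). (coord a k - coord a (k - 1)) * tail_sum k d)"
    unfolding tail_sum_def by (rule abel_summation_tail) (simp add: Suc_leI)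
  also have "\<dots> \<le> coord a 1 * tail_sum 1 d"
  proof -
    have "(coord a k - coord a (k - 1)) * tail_sum k d \<le> 0" if k: "k \<in> {2..CARD('n)}" for k
    proof -
      obtain i :: 'n where i: "pos i = k" using pos_surj[where 'n='n, of k] k by auto
      have "k - 1 \<in> {1..CARD('n)}" using k by auto
      then obtain j :: 'n where j: "pos j = k - 1" by (rule pos_surj)
      have "pos j \<le> pos i" using i j by simp
      then have "a $ j \<le> a $ i" using rate_cone_mono[OF a, of j i] by (simp add: pos_le_iff)
      then have "coord a (k - 1) \<le> coord a k"
        using coord_pos[of a i] coord_pos[of a j] unfolding i j by simp
      then show ?thesis using d[OF k] by (simp add: mult_nonneg_nonpos)
    qed
    then have "(\<Sum>k=2..CARD('n). (coord a k - coord a (k - 1)) * tail_sum k d) \<le> 0"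
      by (rule sum_nonpos)
    then show ?thesis by simp
  qed
  finally show ?thesis .
qed

section \<open>Prints and profile of a set with a piecewise linear covering exponent\<close>
lemma vpow_exp_scale: "vpow (exp_scale t a) \<alpha> = exp (- t * (a \<bullet> \<alpha>))"
  by (simp add: vpow_def exp_scale_def powr_def inner_vec_def exp_sum sum_distrib_left algebra_simps flip: sum_negf)

lemma exp_scale_scaleR: "exp_scale t a = exp_scale 1 (t *\<^sub>R a)"
  by (simp add: exp_scale_def vec_eq_iff)

lemma rate_cone_scaleR: "a \<in> rate_cone \<Longrightarrow> t > 0 \<Longrightarrow> t *\<^sub>R a \<in> rate_cone"
  by (auto simp: rate_cone_def)

lemma exp_scale_admissible: "a \<in> rate_cone \<Longrightarrow> exp_scale 1 a \<in> admissible_scales"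
  by (auto simp: rate_cone_def admissible_scales_def exp_scale_def)

lemma admissible_scalesE:
  fixes \<delta> :: "real ^ 'n::{finite,linorder}"
  assumes "\<delta> \<in> admissible_scales"
  obtains a where "a \<in> rate_cone" "\<delta> = exp_scale 1 a"
proof (rule that)
  show "(\<chi> i. - ln (\<delta> $ i)) \<in> rate_cone" "\<delta> = exp_scale 1 (\<chi> i. - ln (\<delta> $ i))"
    using assms by (auto simp: admissible_scales_def rate_cone_def exp_scale_def vec_eq_iff)
qed

text \<open>
  In the logarithmic coordinates \<open>\<delta>\<^sub>i = exp (- a\<^sub>i)\<close> the limits defining the prints become limits
  over the rate cone as the smallest rate tends to infinity.
\<close>
lemma eventually_scales_to_0:
  fixes P :: "real ^ 'n::{finite,linorder} \<Rightarrow> bool"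
  shows "eventually P scales_to_0 \<longleftrightarrow>
    (\<exists>A. \<forall>a\<in>rate_cone. coord a 1 > A \<longrightarrow> P (exp_scale 1 a))" (is "?L \<longleftrightarrow> ?R")
proof -
  have cexp: "coord (exp_scale 1 a) k = exp (- coord a k)" for k and a :: "real ^ 'n::{finite,linorder}"
    by (simp add: coord_def exp_scale_def)
  have "?L \<longleftrightarrow> (\<exists>b>0. \<forall>\<delta>\<in>admissible_scales. 0 < coord \<delta> 1 \<and> coord \<delta> 1 < b \<longrightarrow> P \<delta>)"
    (is "_ \<longleftrightarrow> ?M")
  proof
    assume ?L
    then obtain Q where Q: "eventually Q (at_right (0::real))"
        "\<And>\<delta>::real ^ 'n::{finite,linorder}. Q (coord \<delta> 1) \<Longrightarrow> \<delta> \<in> admissible_scales \<Longrightarrow> P \<delta>"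
      unfolding scales_to_0_def eventually_inf_principal eventually_filtercomap by blast
    then obtain b where "b > 0" "\<And>y. 0 < y \<Longrightarrow> y < b \<Longrightarrow> Q y"
      by (auto simp: eventually_at_right_field)
    then show ?M using Q(2) by (intro exI[of _ b]) auto
  next
    assume ?M
    then obtain b where b: "b > 0" "\<forall>\<delta>\<in>admissible_scales. 0 < coord \<delta> 1 \<and> coord \<delta> 1 < b \<longrightarrow> P \<delta>"
      by blast
    have "eventually (\<lambda>y. 0 < y \<and> y < b) (at_right (0::real))"
      unfolding eventually_at_right_field using b(1) by blast
    then show ?L
      unfolding scales_to_0_def eventually_inf_principal eventually_filtercomap using b(2) by blast
  qed
  also have "?M \<longleftrightarrow> ?R"
  proof
    assume ?M
    then obtain b where b: "b > 0" "\<And>\<delta>. \<delta> \<in> admissible_scales \<Longrightarrow> 0 < coord \<delta> 1 \<Longrightarrow> coord \<delta> 1 < b \<Longrightarrow> P \<delta>"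
      by blast
    have "P (exp_scale 1 a)" if "a \<in> rate_cone" "coord a 1 > - ln b" for a :: "real ^ 'n::{finite,linorder}"
    proof (rule b(2))
      have "exp (- coord a 1) < exp (ln b)" using that by simp
      then show "coord (exp_scale 1 a) 1 < b" using b by (simp add: cexp)
    qed (use that in \<open>auto simp: cexp exp_scale_admissible\<close>)
    then show ?R by blast
  next
    assume ?R
    then obtain A where A: "\<And>a. a \<in> rate_cone \<Longrightarrow> coord a 1 > A \<Longrightarrow> P (exp_scale 1 a)" by blast
    show ?M
    proof (intro exI[of _ "exp (- A)"] conjI ballI impI)
      fix \<delta> :: "real ^ 'n::{finite,linorder}" assume "\<delta> \<in> admissible_scales" and l: "0 < coord \<delta> 1 \<and> coord \<delta> 1 < exp (- A)"
      then obtain a where a: "a \<in> rate_cone" "\<delta> = exp_scale 1 a" by (elim admissible_scalesE)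
      then show "P \<delta>" using A[OF a(1)] l by (simp add: cexp)
    qed simp
  qed
  finally show ?thesis .
qed

text \<open>
  The support function of \<open>V\<close>, equivalently of its convex hull (for finite nonempty \<open>V\<close>).
\<close>
definition support_max :: "(real ^ 'n::{finite,linorder}) set \<Rightarrow> real ^ 'n::{finite,linorder} \<Rightarrow> real"
  where "support_max V a = Max ((\<bullet>) a ` V)"

lemma support_max_scaleR:
  assumes "finite V" "V \<noteq> {}" "t > 0"
  shows "support_max V (t *\<^sub>R a) = t * support_max V a"
proof -
  have "Max ((\<lambda>x. t * x) ` ((\<bullet>) a ` V)) = t * Max ((\<bullet>) a ` V)"
    using assms by (intro mono_Max_commute[symmetric] monoI) (auto intro: mult_left_mono)
  then show ?thesis by (simp add: support_max_def image_image)
qed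

lemma inner_le_support_max: "finite V \<Longrightarrow> p \<in> V \<Longrightarrow> a \<bullet> p \<le> support_max V a"
  by (simp add: support_max_def)

lemma support_max_attained:
  assumes "finite V" "V \<noteq> {}"
  obtains p where "p \<in> V" "support_max V a = a \<bullet> p"
proof -
  have "support_max V a \<in> (\<bullet>) a ` V" unfolding support_max_def using assms by (intro Max_in) auto
  then show ?thesis using that by auto
qed

lemma inner_le_support_max_hull:
  assumes "finite V" "p \<in> convex hull V"
  shows "a \<bullet> p \<le> support_max V a"
proof -
  have "convex hull V \<subseteq> {x. a \<bullet> x \<le> support_max V a}"
    by (intro hull_minimal convex_halfspace_le) (auto intro: inner_le_support_max assms)
  then show ?thesis using assms by auto
qed

text \<open>
  Up to constants \<open>N(F; \<delta>)\<close> is the largest of the monomials \<open>\<delta>\<^sup>-\<^sup>p\<close> with \<open>p \<in> V\<close>. Stating this at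
  \<open>t = 1\<close> loses nothing, since both sides depend on \<open>t\<close> and \<open>a\<close> through \<open>t a\<close> only.
\<close>
definition cover_comparable :: "(real ^ 'n::{finite,linorder}) set \<Rightarrow> (real ^ 'n::{finite,linorder}) set \<Rightarrow> bool"
  where "cover_comparable F V \<longleftrightarrow> finite V \<and> V \<noteq> {} \<and>
    (\<exists>c>0. \<exists>C>0. \<forall>a\<in>rate_cone.
       c * exp (support_max V a) \<le> real (cover_number F (exp_scale 1 a)) \<and>
       real (cover_number F (exp_scale 1 a)) \<le> C * exp (support_max V a))"

lemma cover_comparableE:
  assumes "cover_comparable F V"
  obtains c C where "c > 0" "C > 0"
    "\<And>a t. a \<in> rate_cone \<Longrightarrow> t > 0 \<Longrightarrow>
       c * exp (t * support_max V a) \<le> real (cover_number F (exp_scale t a))"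
    "\<And>a t. a \<in> rate_cone \<Longrightarrow> t > 0 \<Longrightarrow>
       real (cover_number F (exp_scale t a)) \<le> C * exp (t * support_max V a)"
proof -
  from assms obtain c C where V: "finite V" "V \<noteq> {}" and cC: "c > 0" "C > 0" "\<And>a. a \<in> rate_cone \<Longrightarrow>
       c * exp (support_max V a) \<le> real (cover_number F (exp_scale 1 a)) \<and>
       real (cover_number F (exp_scale 1 a)) \<le> C * exp (support_max V a)"
    unfolding cover_comparable_def by blast
  show ?thesis
    by (rule that[OF cC(1,2)])
      (use cC(3)[OF rate_cone_scaleR] V in \<open>auto simp: support_max_scaleR simp flip: exp_scale_scaleR\<close>)
qed

lemma cover_comparable_profile:
  assumes FV: "cover_comparable F V" and a: "a \<in> rate_cone"
  shows "((\<lambda>t. 1 / t * ln (real (cover_number F (exp_scale t a)))) \<longlongrightarrow> support_max V a) at_top"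
proof -
  obtain c C where c: "c > 0" and C: "C > 0" and
    lo: "\<And>t. t > 0 \<Longrightarrow> c * exp (t * support_max V a) \<le> real (cover_number F (exp_scale t a))" and
    up: "\<And>t. t > 0 \<Longrightarrow> real (cover_number F (exp_scale t a)) \<le> C * exp (t * support_max V a)"
    using cover_comparableE[OF FV] a by metis
  have lim: "((\<lambda>t. ln k / t + support_max V a) \<longlongrightarrow> support_max V a) at_top" for k
  proof -
    have "((\<lambda>t. ln k / t + support_max V a) \<longlongrightarrow> 0 + support_max V a) at_top"
      by (intro tendsto_add tendsto_const tendsto_divide_0[OF tendsto_const]
          filterlim_at_top_imp_at_infinity filterlim_ident)
    then show ?thesis by simp
  qed
  have ln: "1 / t * ln (k * exp (t * support_max V a)) = ln k / t + support_max V a"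
    if "t > 0" "k > 0" for t k
    using that by (simp add: ln_mult field_simps)
  show ?thesis
  proof (rule tendsto_sandwich[OF _ _ lim[of c] lim[of C]]; rule eventually_mono[OF eventually_gt_at_top[of 0]])
    fix t :: real assume t: "t > 0"
    have "0 < c * exp (t * support_max V a)" using c by simp
    then have "ln (c * exp (t * support_max V a)) \<le> ln (real (cover_number F (exp_scale t a)))"
      "ln (real (cover_number F (exp_scale t a))) \<le> ln (C * exp (t * support_max V a))"
      using lo[OF t] up[OF t] by (auto intro!: ln_mono)
    then show "ln c / t + support_max V a \<le> 1 / t * ln (real (cover_number F (exp_scale t a)))"
      "1 / t * ln (real (cover_number F (exp_scale t a))) \<le> ln C / t + support_max V a"
      using t c C by (auto simp flip: ln intro!: divide_right_mono)
  qed
qed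

lemma cover_comparable_profile_eq:
  assumes "cover_comparable F V" "a \<in> rate_cone"
  shows "profile F a = support_max V a"
  unfolding profile_def by (rule tendsto_Lim[OF _ cover_comparable_profile[OF assms]]) simp

lemma cover_comparable_uniformly_profile_regular:
  fixes F :: "(real ^ 'n::{finite,linorder}) set"
  assumes FV: "cover_comparable F V"
  shows "uniformly_profile_regular F"
proof -
  obtain c C where c: "c > 0" and C: "C > 0" and
    lo: "\<And>a t. a \<in> rate_cone \<Longrightarrow> t > 0 \<Longrightarrow> c * exp (t * support_max V a) \<le> real (cover_number F (exp_scale t a))" and
    up: "\<And>a t. a \<in> rate_cone \<Longrightarrow> t > 0 \<Longrightarrow> real (cover_number F (exp_scale t a)) \<le> C * exp (t * support_max V a)"
    using cover_comparableE[OF FV] by metis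
  define K where "K = max 1 (max (inverse c) C)"
  have "inverse K \<le> inverse (inverse c)"
    using c by (intro le_imp_inverse_le) (auto simp: K_def)
  then have K: "K \<ge> 1" "inverse K \<le> c" "C \<le> K" by (auto simp: K_def)
  show ?thesis
    unfolding uniformly_profile_regular_def
  proof (intro conjI exI[of _ K] ballI allI impI)
    show "profile_exists F"
      unfolding profile_exists_def using cover_comparable_profile[OF FV] by blast
    fix a :: "real ^ 'n::{finite,linorder}" and t :: real assume "a \<in> normalized_rates" and t: "K \<le> t"
    then have a: "a \<in> rate_cone" by (simp add: normalized_rates_def)
    have t0: "t > 0" using t K(1) by simp
    show "inverse K * exp (t * profile F a) \<le> real (cover_number F (exp_scale t a))"
      unfolding cover_comparable_profile_eq[OF FV a]
      by (rule order.trans[OF mult_right_mono[OF K(2)] lo[OF a t0]]) simp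
    show "real (cover_number F (exp_scale t a)) \<le> K * exp (t * profile F a)"
      unfolding cover_comparable_profile_eq[OF FV a]
      by (rule order.trans[OF up[OF a t0] mult_right_mono[OF K(3)]]) simp
  qed (use K in auto)
qed

text \<open>
  The exponent \<open>support_max V a - a \<bullet> \<alpha>\<close> of \<open>N(F; \<delta>) \<delta>\<^sup>\<alpha>\<close> is homogeneous in \<open>a\<close>: one negative
  value would give, along the ray through \<open>a\<close>, values tending to minus infinity.
\<close>
lemma lower_print_iff:
  fixes F :: "(real ^ 'n::{finite,linorder}) set"
  assumes FV: "cover_comparable F V"
  shows "\<alpha> \<in> lower_print F \<longleftrightarrow> \<alpha> \<in> orthant \<and> (\<forall>a\<in>rate_cone. a \<bullet> \<alpha> \<le> support_max V a)"
proof -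
  obtain c C where c: "c > 0" and C: "C > 0" and
    lo: "\<And>a t. a \<in> rate_cone \<Longrightarrow> t > 0 \<Longrightarrow> c * exp (t * support_max V a) \<le> real (cover_number F (exp_scale t a))" and
    up: "\<And>a t. a \<in> rate_cone \<Longrightarrow> t > 0 \<Longrightarrow> real (cover_number F (exp_scale t a)) \<le> C * exp (t * support_max V a)"
    using cover_comparableE[OF FV] by metis
  let ?N = "\<lambda>\<delta>. real (cover_number F \<delta>) * vpow \<delta> \<alpha>"
  have "(0 < Liminf scales_to_0 (\<lambda>\<delta>. ereal (?N \<delta>))) \<longleftrightarrow> (\<forall>a\<in>rate_cone. a \<bullet> \<alpha> \<le> support_max V a)"
    (is "?L \<longleftrightarrow> ?R")
  proof
    assume ?R
    have "eventually (\<lambda>\<delta>. ereal c \<le> ereal (?N \<delta>)) scales_to_0"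
      unfolding eventually_scales_to_0
    proof (intro exI[of _ 0] ballI impI)
      fix a :: "real ^ 'n::{finite,linorder}" assume a: "a \<in> rate_cone"
      have "c * 1 \<le> c * exp (support_max V a - a \<bullet> \<alpha>)" using \<open>?R\<close> a c by (intro mult_left_mono) auto
      also have "\<dots> = c * exp (1 * support_max V a) * exp (- (a \<bullet> \<alpha>))" by (simp add: exp_diff exp_minus field_simps)
      also have "\<dots> \<le> real (cover_number F (exp_scale 1 a)) * exp (- (a \<bullet> \<alpha>))"
        by (intro mult_right_mono lo a) auto
      finally show "ereal c \<le> ereal (?N (exp_scale 1 a))" by (simp add: vpow_exp_scale)
    qed
    then have "ereal c \<le> Liminf scales_to_0 (\<lambda>\<delta>. ereal (?N \<delta>))"
      by (rule Liminf_bounded)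
    moreover have "0 < ereal c" using c by simp
    ultimately show ?L by (rule less_le_trans[rotated])
  next
    assume ?L
    then obtain y where "y < Liminf scales_to_0 (\<lambda>\<delta>. ereal (?N \<delta>))" "0 < y" using dense by blast
    then obtain r where r: "r > 0" and "eventually (\<lambda>\<delta>. r < ?N \<delta>) scales_to_0"
      by (cases y) (auto dest!: less_LiminfD)
    then obtain A where A: "\<And>a. a \<in> rate_cone \<Longrightarrow> coord a 1 > A \<Longrightarrow> r < ?N (exp_scale 1 a)"
      unfolding eventually_scales_to_0 by blast
    show ?R
    proof (intro ballI, rule ccontr)
      fix a :: "real ^ 'n::{finite,linorder}" assume a: "a \<in> rate_cone" and "\<not> a \<bullet> \<alpha> \<le> support_max V a"
      then obtain s where s: "s > 0" "s = a \<bullet> \<alpha> - support_max V a" by auto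
      have a1: "coord a 1 > 0" using rate_cone_pos[OF a] by (simp add: coord_def)
      have r2: "r < C * exp (- (t * s))" if "t > 0" "t * coord a 1 > A" for t
      proof -
        have "coord (t *\<^sub>R a) 1 > A" using that by (simp add: coord_def)
        from A[OF rate_cone_scaleR[OF a that(1)] this]
        have "r < real (cover_number F (exp_scale t a)) * exp (- t * (a \<bullet> \<alpha>))"
          by (simp add: vpow_exp_scale flip: exp_scale_scaleR)
        also have "\<dots> \<le> C * exp (t * support_max V a) * exp (- t * (a \<bullet> \<alpha>))"
          by (intro mult_right_mono up a that) auto
        also have "\<dots> = C * exp (- (t * s))" by (simp add: s(2) algebra_simps exp_diff exp_minus field_simps)
        finally show ?thesis .
      qed
      have "((\<lambda>t. C * exp (- (t * s))) \<longlongrightarrow> C * 0) at_top"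
        by (intro tendsto_mult tendsto_const filterlim_compose[OF exp_at_bot]
            filterlim_compose[OF filterlim_uminus_at_bot_at_top]
            filterlim_at_top_mult_tendsto_pos[OF tendsto_const] filterlim_ident s)
      then have "eventually (\<lambda>t. C * exp (- (t * s)) < r) at_top"
        using r by (auto dest: order_tendstoD)
      moreover have "eventually (\<lambda>t. t > A / coord a 1 \<and> t > 0) at_top"
        by (intro eventually_conj eventually_gt_at_top)
      ultimately have "eventually (\<lambda>t::real. False) at_top"
        by eventually_elim (use a1 r2 in \<open>fastforce simp: field_simps\<close>)
      then show False by simp
    qed
  qed
  then show ?thesis by (simp add: lower_print_def)
qed

text \<open>
  A minimax statement. If no point of the hull dominates \<open>\<alpha>\<close> in all tail sums, a hyperplane with
  normal \<open>a\<close> strictly separates the compact hull from the closed convex set \<open>T\<close> of all vectors that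
  do. As \<open>T\<close> is invariant under adding vectors with nonnegative tail sums, \<open>a\<close> is nonnegative on
  those vectors. The unit vectors and the differences of a later and an earlier unit vector are among
  them, which makes \<open>a\<close> nonnegative and increasing. Its entries may vanish, but a small multiple of
  the all-one vector moves \<open>a\<close> into the rate cone and keeps the strict inequality.
\<close>
lemma majorized_by_hull_iff:
  fixes V :: "(real ^ 'n::{finite,linorder}) set"
  assumes V: "finite V" "V \<noteq> {}"
  shows "(\<forall>a\<in>rate_cone. a \<bullet> \<alpha> \<le> support_max V a) \<longleftrightarrow>
    (\<exists>p\<in>convex hull V. \<forall>k\<in>{1..CARD('n)}. tail_sum k \<alpha> \<le> tail_sum k p)" (is "?L \<longleftrightarrow> ?R")
proof
  assume ?R
  then obtain p where p: "p \<in> convex hull V" "\<And>k. k \<in> {1..CARD('n)} \<Longrightarrow> tail_sum k \<alpha> \<le> tail_sum k p"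
    by blast
  show ?L
  proof
    fix a :: "real ^ 'n::{finite,linorder}" assume a: "a \<in> rate_cone"
    have "a \<bullet> (\<alpha> - p) \<le> coord a 1 * tail_sum 1 (\<alpha> - p)"
      using p(2) by (intro inner_le_first_mult_tail_sum[OF a]) (simp add: tail_sum_diff)
    also have "\<dots> \<le> 0"
      using p(2)[of 1] rate_cone_pos[OF a]
      by (intro mult_nonneg_nonpos) (auto simp: coord_def tail_sum_diff Suc_leI intro: less_imp_le)
    finally show "a \<bullet> \<alpha> \<le> support_max V a"
      using inner_le_support_max_hull[OF V(1) p(1), of a] by (simp add: inner_diff_right)
  qed
next
  assume L: ?L
  show ?R
  proof (rule ccontr)
    define T :: "(real ^ 'n::{finite,linorder}) set" where "T = {q. \<forall>k\<in>{1..CARD('n)}. tail_sum k \<alpha> \<le> tail_sum k q}"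
    assume "\<not> ?R"
    then have disj: "convex hull V \<inter> T = {}" by (auto simp: T_def)
    have T: "T = (\<Inter>k\<in>{1..CARD('n)}. {q. (\<chi> i. if k \<le> pos i then 1 else 0) \<bullet> q \<ge> tail_sum k \<alpha>})"
      by (auto simp: T_def tail_sum_conv_inner)
    have "closed T"
      unfolding T by (intro closed_INT ballI closed_halfspace_ge)
    moreover have "convex T"
      unfolding T by (intro convex_INT convex_halfspace_ge)
    moreover have "compact (convex hull V)" "convex (convex hull V)" "convex hull V \<noteq> {}"
      using V by (auto intro: finite_imp_compact_convex_hull)
    moreover have \<alpha>T: "\<alpha> \<in> T" by (simp add: T_def)
    ultimately obtain a b where ab: "\<And>p. p \<in> convex hull V \<Longrightarrow> a \<bullet> p < b" "\<And>q. q \<in> T \<Longrightarrow> b < a \<bullet> q"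
      using separating_hyperplane_compact_closed[of "convex hull V" T] disj by metis
    have dual: "a \<bullet> z \<ge> 0" if z: "\<And>k. k \<in> {1..CARD('n)} \<Longrightarrow> 0 \<le> tail_sum k z" for z
    proof (rule ccontr)
      assume neg: "\<not> a \<bullet> z \<ge> 0"
      define s where "s = (a \<bullet> \<alpha> - b) / (- (a \<bullet> z))"
      have "s \<ge> 0" using neg ab(2)[OF \<alpha>T] by (auto simp: s_def intro!: divide_nonneg_neg)
      then have "\<alpha> + s *\<^sub>R z \<in> T" using z by (simp add: T_def tail_sum_add tail_sum_scaleR)
      from ab(2)[OF this] have "b < a \<bullet> \<alpha> + s * (a \<bullet> z)" by (simp add: inner_add_right)
      also have "\<dots> = b" using neg by (simp add: s_def)
      finally show False by simp
    qed
    have a_nonneg: "a $ i \<ge> 0" for i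
      using dual[of "axis i 1"] by (simp add: tail_sum_axis inner_axis)
    have a_mono: "a $ i \<le> a $ j" if "i \<le> j" for i j
    proof -
      have "pos i \<le> pos j" using that by (simp add: pos_le_iff)
      then show ?thesis
        using dual[of "axis j 1 - axis i 1"]
        by (auto simp: tail_sum_axis tail_sum_diff inner_axis inner_diff_right)
    qed
    \<comment> \<open>\<open>K\<close> bounds the change in any \<open>p \<in> V\<close> per unit of the perturbation; \<open>e\<close> is small enough for the
       gap \<open>a \<bullet> \<alpha> - b\<close> to absorb it.\<close>
    define K where "K = (\<Sum>p\<in>V. \<bar>(\<chi> i. 1) \<bullet> (p - \<alpha>)\<bar>)"
    define e where "e = (a \<bullet> \<alpha> - b) / (1 + K)"
    have K: "K \<ge> 0" unfolding K_def by (rule sum_nonneg) auto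
    have e: "e > 0" using K ab(2)[OF \<alpha>T] by (simp add: e_def)
    define a' where "a' = a + e *\<^sub>R (\<chi> i. 1)"
    have "a' \<in> rate_cone" using a_nonneg a_mono e by (auto simp: rate_cone_def a'_def add_nonneg_pos)
    with L obtain p where p: "p \<in> V" "a' \<bullet> \<alpha> \<le> a' \<bullet> p"
      using support_max_attained[OF V, of a'] by metis
    have "a' \<bullet> (p - \<alpha>) = (a \<bullet> p - a \<bullet> \<alpha>) + e * ((\<chi> i. 1) \<bullet> (p - \<alpha>))"
      by (simp add: a'_def inner_add_left inner_diff_right right_diff_distrib)
    also have "e * ((\<chi> i. 1) \<bullet> (p - \<alpha>)) \<le> e * (1 + K)"
    proof (rule mult_left_mono)
      have "\<bar>(\<chi> i. 1) \<bullet> (p - \<alpha>)\<bar> \<le> K" unfolding K_def by (rule member_le_sum) (use p V in auto)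
      then show "(\<chi> i. 1) \<bullet> (p - \<alpha>) \<le> 1 + K" by linarith
    qed (use e in simp)
    also have "e * (1 + K) = a \<bullet> \<alpha> - b" using K by (simp add: e_def)
    also have "a \<bullet> p - a \<bullet> \<alpha> + (a \<bullet> \<alpha> - b) < 0" using ab(1)[of p] p(1) by (simp add: hull_inc)
    finally show False using p(2) by (simp add: inner_diff_right)
  qed
qed

theorem cover_comparable_lower_print:
  fixes F :: "(real ^ 'n::{finite,linorder}) set"
  assumes FV: "cover_comparable F V"
  shows "lower_print F =
    {\<alpha> \<in> orthant. \<exists>p\<in>convex hull V. \<forall>k\<in>{1..CARD('n)}. tail_sum k \<alpha> \<le> tail_sum k p}"
proof -
  have "finite V" "V \<noteq> {}" using FV by (auto simp: cover_comparable_def)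
  then show ?thesis
    using lower_print_iff[OF FV] majorized_by_hull_iff[of V] by blast
qed

text \<open>
  Now one sequence of scales with \<open>N(F; \<delta>) \<delta>\<^sup>\<alpha>\<close> bounded below is enough. For \<open>d = p - \<alpha>\<close>, Abel
  summation shows which rates keep \<open>a \<bullet> d\<close> bounded below as the smallest rate grows: if
  \<open>tail_sum 1 d \<ge> 0\<close>, constant rates do; if \<open>tail_sum k d > 0\<close> for some \<open>k \<ge> 2\<close>, the last rates from
  position \<open>k\<close> on can be raised independently of the first. In all other cases \<open>a \<bullet> d\<close> is at most
  the first rate times the negative number \<open>tail_sum 1 d\<close>. This explains the weak inequality for
  \<open>k = 1\<close> and the strict ones for \<open>k \<ge> 2\<close>.
\<close>
theorem cover_comparable_upper_print:
  fixes F :: "(real ^ 'n::{finite,linorder}) set"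
  assumes FV: "cover_comparable F V"
  shows "upper_print F =
    {\<alpha> \<in> orthant. \<exists>p\<in>V. tail_sum 1 \<alpha> \<le> tail_sum 1 p \<or> (\<exists>k\<in>{2..CARD('n)}. tail_sum k \<alpha> < tail_sum k p)}"
proof -
  have V: "finite V" "V \<noteq> {}" using FV by (auto simp: cover_comparable_def)
  obtain c C where c: "c > 0" and C: "C > 0" and
    lo: "\<And>a t. a \<in> rate_cone \<Longrightarrow> t > 0 \<Longrightarrow> c * exp (t * support_max V a) \<le> real (cover_number F (exp_scale t a))" and
    up: "\<And>a t. a \<in> rate_cone \<Longrightarrow> t > 0 \<Longrightarrow> real (cover_number F (exp_scale t a)) \<le> C * exp (t * support_max V a)"
    using cover_comparableE[OF FV] by metis
  have "(0 < Limsup scales_to_0 (\<lambda>\<delta>. ereal (real (cover_number F \<delta>) * vpow \<delta> \<alpha>))) \<longleftrightarrow>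
     (\<exists>p\<in>V. tail_sum 1 \<alpha> \<le> tail_sum 1 p \<or> (\<exists>k\<in>{2..CARD('n)}. tail_sum k \<alpha> < tail_sum k p))"
    (is "0 < Limsup _ (\<lambda>\<delta>. ereal (?N \<delta>)) \<longleftrightarrow> ?R") for \<alpha>
  proof
    assume ?R
    then obtain p where p: "p \<in> V"
      "tail_sum 1 \<alpha> \<le> tail_sum 1 p \<or> (\<exists>k\<in>{2..CARD('n)}. tail_sum k \<alpha> < tail_sum k p)" by blast
    have ex: "\<exists>a\<in>rate_cone. coord a 1 > A \<and> a \<bullet> \<alpha> \<le> a \<bullet> p" for A
    proof -
      define A' where "A' = max A 0 + 1"
      have sum1: "tail_sum 1 (p - \<alpha>) = (\<Sum>i\<in>UNIV. (p - \<alpha>) $ i)"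
        by (simp add: tail_sum_eq_sum_pos pos_ge_1[simplified])
      obtain k B where B: "B \<ge> 0" "1 \<le> k" "0 \<le> A' * tail_sum 1 (p - \<alpha>) + B * tail_sum k (p - \<alpha>)"
        "k \<ge> 2 \<or> B = 0"
        using p(2)
      proof
        assume "tail_sum 1 \<alpha> \<le> tail_sum 1 p"
        then have "0 \<le> A' * tail_sum 1 (p - \<alpha>) + 0 * tail_sum 2 (p - \<alpha>)"
          by (simp add: tail_sum_diff A'_def)
        then show ?thesis by (intro that[of 0 2]) auto
      next
        assume "\<exists>k\<in>{2..CARD('n)}. tail_sum k \<alpha> < tail_sum k p"
        then obtain k where k: "k \<ge> 2" "0 < tail_sum k (p - \<alpha>)" by (auto simp: tail_sum_diff)
        \<comment> \<open>the increment that compensates for a possibly negative contribution of the first tail sum\<close>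
        define B where "B = A' * \<bar>tail_sum 1 (p - \<alpha>)\<bar> / tail_sum k (p - \<alpha>)"
        have "B \<ge> 0" using k by (auto simp: B_def A'_def)
        moreover have "B * tail_sum k (p - \<alpha>) = \<bar>A' * tail_sum 1 (p - \<alpha>)\<bar>"
          using k by (simp add: B_def A'_def abs_mult)
        ultimately show ?thesis using k by (intro that[of B k]) auto
      qed
      define a :: "real ^ 'n::{finite,linorder}" where "a = (\<chi> i. A' + (if k \<le> pos i then 1 else 0) * B)"
      have "pos i \<le> pos j" if "i \<le> j" for i j :: 'n using that by (simp add: pos_le_iff)
      then have "a \<in> rate_cone"
        using B(1) by (fastforce simp: rate_cone_def a_def A'_def add_pos_nonneg)
      moreover have "A < a $ j" for j
      proof -
        have "A < A'" by (simp add: A'_def)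
        also have "A' \<le> a $ j" using B(1) by (simp add: a_def)
        finally show ?thesis .
      qed
      then have "coord a 1 > A" by (simp add: coord_def)
      moreover have "a \<bullet> (p - \<alpha>) = A' * tail_sum 1 (p - \<alpha>) + B * tail_sum k (p - \<alpha>)"
        unfolding sum1 tail_sum_eq_sum_pos[OF B(2)]
        by (simp add: a_def inner_vec_def sum_distrib_left algebra_simps flip: sum.distrib)
      ultimately show ?thesis using B(3) by (intro bexI[of _ a]) (auto simp: inner_diff_right)
    qed
    show "0 < Limsup scales_to_0 (\<lambda>\<delta>. ereal (?N \<delta>))"
    proof (rule ccontr)
      assume "\<not> 0 < Limsup scales_to_0 (\<lambda>\<delta>. ereal (?N \<delta>))"
      then have "Limsup scales_to_0 (\<lambda>\<delta>. ereal (?N \<delta>)) \<le> 0" by (simp add: not_less)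
      also have "0 < ereal c" using c by simp
      finally have "Limsup scales_to_0 (\<lambda>\<delta>. ereal (?N \<delta>)) < ereal c" .
      then have "eventually (\<lambda>\<delta>. ?N \<delta> < c) scales_to_0" by (auto dest: Limsup_lessD)
      then obtain A where A: "\<And>a. a \<in> rate_cone \<Longrightarrow> coord a 1 > A \<Longrightarrow> ?N (exp_scale 1 a) < c"
        unfolding eventually_scales_to_0 by blast
      obtain a where a: "a \<in> rate_cone" "coord a 1 > A" "a \<bullet> \<alpha> \<le> a \<bullet> p" using ex by blast
      have "c * 1 \<le> c * exp (support_max V a - a \<bullet> \<alpha>)"
        using inner_le_support_max[OF V(1) p(1), of a] a(3) c by (intro mult_left_mono) auto
      also have "\<dots> = c * exp (1 * support_max V a) * exp (- (a \<bullet> \<alpha>))" by (simp add: exp_diff exp_minus field_simps)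
      also have "\<dots> \<le> real (cover_number F (exp_scale 1 a)) * exp (- (a \<bullet> \<alpha>))"
        by (intro mult_right_mono lo a) auto
      finally show False using A[OF a(1,2)] by (simp add: vpow_exp_scale)
    qed
  next
    assume pos: "0 < Limsup scales_to_0 (\<lambda>\<delta>. ereal (?N \<delta>))"
    show ?R
    proof (rule ccontr)
      assume nR: "\<not> ?R"
      have 1: "tail_sum 1 (p - \<alpha>) < 0" and 2: "\<And>k. k \<in> {2..CARD('n)} \<Longrightarrow> tail_sum k (p - \<alpha>) \<le> 0"
        if "p \<in> V" for p using nR that by (auto simp: tail_sum_diff not_le not_less)
      define s where "s = - Max ((\<lambda>p. tail_sum 1 (p - \<alpha>)) ` V)"
      have s: "s > 0" using V 1 by (auto simp: s_def)
      have bd: "?N (exp_scale 1 a) \<le> C * exp (- (coord a 1 * s))" if a: "a \<in> rate_cone" for a :: "real ^ 'n::{finite,linorder}"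
      proof -
        obtain p where p: "p \<in> V" "support_max V a = a \<bullet> p" using support_max_attained[OF V] by metis
        have "a \<bullet> (p - \<alpha>) \<le> coord a 1 * tail_sum 1 (p - \<alpha>)"
          by (rule inner_le_first_mult_tail_sum[OF a 2[OF p(1)]])
        also have "\<dots> \<le> coord a 1 * (- s)"
        proof (rule mult_left_mono)
          have "tail_sum 1 (p - \<alpha>) \<le> Max ((\<lambda>p. tail_sum 1 (p - \<alpha>)) ` V)"
            using V p(1) by (intro Max_ge) auto
          then show "tail_sum 1 (p - \<alpha>) \<le> - s" unfolding s_def minus_minus .
          show "0 \<le> coord a 1" using rate_cone_pos[OF a] by (simp add: coord_def less_imp_le)
        qed
        finally have h: "support_max V a - a \<bullet> \<alpha> \<le> - (coord a 1 * s)" by (simp add: p(2) inner_diff_right)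
        have "?N (exp_scale 1 a) \<le> C * exp (1 * support_max V a) * exp (- 1 * (a \<bullet> \<alpha>))"
          unfolding vpow_exp_scale by (intro mult_right_mono up a) auto
        also have "\<dots> = C * exp (support_max V a - a \<bullet> \<alpha>)" by (simp add: exp_diff exp_minus field_simps)
        also have "\<dots> \<le> C * exp (- (coord a 1 * s))" using h C by simp
        finally show ?thesis .
      qed
      have lim: "((\<lambda>t. C * exp (- (t * s))) \<longlongrightarrow> C * 0) at_top"
        by (intro tendsto_mult tendsto_const filterlim_compose[OF exp_at_bot]
            filterlim_compose[OF filterlim_uminus_at_bot_at_top]
            filterlim_at_top_mult_tendsto_pos[OF tendsto_const] filterlim_ident s)
      from pos obtain y where y: "0 < y" "y < Limsup scales_to_0 (\<lambda>\<delta>. ereal (?N \<delta>))" using dense by blast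
      then obtain r where r: "0 < r" "ereal r \<le> y"  by (cases y) auto
      from lim r(1) have "eventually (\<lambda>t. C * exp (- (t * s)) < r) at_top" by (auto dest: order_tendstoD)
      then obtain A where A: "\<And>t. t \<ge> A \<Longrightarrow> C * exp (- (t * s)) < r"
        by (auto simp: eventually_at_top_linorder)
      have "eventually (\<lambda>\<delta>. ereal (?N \<delta>) \<le> ereal r) scales_to_0"
        unfolding eventually_scales_to_0
      proof (intro exI[of _ A] ballI impI)
        fix a :: "real ^ 'n::{finite,linorder}" assume a: "a \<in> rate_cone" "A < coord a 1"
        have "?N (exp_scale 1 a) \<le> C * exp (- (coord a 1 * s))" by (rule bd[OF a(1)])
        also have "\<dots> < r" by (rule A[OF less_imp_le[OF a(2)]])
        finally show "ereal (?N (exp_scale 1 a)) \<le> ereal r" by simp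
      qed
      then have "Limsup scales_to_0 (\<lambda>\<delta>. ereal (?N \<delta>)) \<le> ereal r" by (rule Limsup_bounded)
      also note r(2)
      finally show False using y(2) by (simp add: not_less[symmetric])
    qed
  qed
  then show ?thesis by (simp add: upper_print_def)
qed

section \<open>Covering the sphere from above\<close>
lemma rotate_to_axis:
  fixes x y h :: real
  assumes h: "0 < h" "h \<le> pi / 2"
  obtains k :: nat where "real k * h \<le> 2 * pi"
    "\<bar>cos (k * h) * x - sin (k * h) * y\<bar> \<le> h * sqrt (x\<^sup>2 + y\<^sup>2)"
    "0 \<le> sin (k * h) * x + cos (k * h) * y"
proof -
  define r where "r = sqrt (x\<^sup>2 + y\<^sup>2)"
  obtain t where t: "0 \<le> t" "t < 2 * pi" and xy: "x = r * sin t" "y = r * cos t"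
  proof (cases "r = 0")
    case True
    then have "x = 0" "y = 0" by (simp_all add: r_def)
    then show ?thesis using that[of 0] True by simp
  next
    case False
    have r2: "r\<^sup>2 = x\<^sup>2 + y\<^sup>2" by (simp add: r_def)
    have "(y / r)\<^sup>2 + (x / r)\<^sup>2 = 1" using False by (simp add: power_divide add_divide_distrib[symmetric] add.commute[of "y\<^sup>2"] r2[symmetric])
    then obtain t where "0 \<le> t" "t < 2 * pi" "y / r = cos t" "x / r = sin t"
      using sincos_total_2pi by metis
    then show ?thesis using that[of t] False by (simp add: field_simps)
  qed
  define k where "k = nat \<lfloor>t / h\<rfloor>"
  have kr: "real k = of_int \<lfloor>t / h\<rfloor>" using t h by (simp add: k_def)
  have 1: "real k * h \<le> t" and 2: "t - real k * h < h"
    using h floor_divide_lower[of h t] floor_divide_upper[of h t] by (simp_all add: kr algebra_simps)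
  have e1: "cos (k * h) * x - sin (k * h) * y = r * sin (t - k * h)"
    and e2: "sin (k * h) * x + cos (k * h) * y = r * cos (t - k * h)"
    by (simp_all add: xy sin_diff cos_diff algebra_simps)
  have r: "r \<ge> 0" by (simp add: r_def)
  show ?thesis
  proof (rule that[of k])
    show "real k * h \<le> 2 * pi" using 1 t by simp
    have "\<bar>sin (t - k * h)\<bar> \<le> \<bar>t - k * h\<bar>" by (rule abs_sin_x_le_abs_x)
    also have "\<dots> \<le> h" using 1 2 by simp
    finally have "r * \<bar>sin (t - k * h)\<bar> \<le> r * h" by (rule mult_left_mono[OF _ r])
    then show "\<bar>cos (k * h) * x - sin (k * h) * y\<bar> \<le> h * sqrt (x\<^sup>2 + y\<^sup>2)"
      unfolding e1 using r by (simp add: abs_mult mult.commute flip: r_def)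
    have "0 \<le> cos (t - k * h)" using 1 2 h by (intro cos_ge_zero) auto
    then show "0 \<le> sin (k * h) * x + cos (k * h) * y" unfolding e2 using r by simp
  qed
qed

definition plane_rotation :: "'n \<Rightarrow> 'n \<Rightarrow> real \<Rightarrow> real ^ 'n \<Rightarrow> real ^ 'n"
  where "plane_rotation i l \<theta> x = (\<chi> k. if k = i then cos \<theta> * x $ i - sin \<theta> * x $ l
     else if k = l then sin \<theta> * x $ i + cos \<theta> * x $ l else x $ k)"

lemma sum_split_two:
  fixes f :: "'n::finite \<Rightarrow> real"
  assumes "i \<noteq> l"
  shows "sum f UNIV = f i + f l + sum f (UNIV - {i, l})"
  using assms by (simp add: sum.remove[of UNIV i] sum.remove[of "UNIV - {i}" l] Diff_insert2[of UNIV i "{l}"] insert_commute)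

lemma orthogonal_plane_rotation:
  assumes "i \<noteq> l"
  shows "orthogonal_transformation (plane_rotation i l \<theta>)"
  unfolding orthogonal_transformation_def
proof (intro conjI allI)
  show "linear (plane_rotation i l \<theta>)"
    by (rule linearI) (auto simp: plane_rotation_def vec_eq_iff algebra_simps)
  fix v w :: "real ^ 'a"
  let ?c = "cos \<theta>" and ?s = "sin \<theta>"
  have sc: "?s * ?s + ?c * ?c = 1"
    using sin_cos_squared_add[of \<theta>] by (simp add: power2_eq_square)
  have "plane_rotation i l \<theta> v \<bullet> plane_rotation i l \<theta> w =
     (?c * v $ i - ?s * v $ l) * (?c * w $ i - ?s * w $ l) +
     (?s * v $ i + ?c * v $ l) * (?s * w $ i + ?c * w $ l) +
     (\<Sum>k\<in>UNIV - {i, l}. v $ k * w $ k)"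
    using assms by (simp add: inner_vec_def sum_split_two[OF assms] plane_rotation_def)
  also have "\<dots> = (?s * ?s + ?c * ?c) * (v $ i * w $ i + v $ l * w $ l) + (\<Sum>k\<in>UNIV - {i, l}. v $ k * w $ k)"
    by algebra
  also have "\<dots> = v \<bullet> w"
    by (simp only: sc) (simp add: inner_vec_def sum_split_two[OF assms])
  finally show "plane_rotation i l \<theta> v \<bullet> plane_rotation i l \<theta> w = v \<bullet> w" .
qed

lemma sqrt_two_coords_le_norm:
  fixes x :: "real ^ 'n"
  assumes "i \<noteq> l"
  shows "sqrt ((x $ i)\<^sup>2 + (x $ l)\<^sup>2) \<le> norm x"
proof -
  have "(norm x)\<^sup>2 = (x $ i)\<^sup>2 + (x $ l)\<^sup>2 + (\<Sum>k\<in>UNIV - {i, l}. (x $ k)\<^sup>2)"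
    unfolding power2_norm_eq_inner inner_vec_def
    by (subst sum_split_two[OF assms]) (simp add: power2_eq_square)
  moreover have "0 \<le> (\<Sum>k\<in>UNIV - {i, l}. (x $ k)\<^sup>2)" by (intro sum_nonneg) auto
  ultimately show ?thesis by (intro real_le_lsqrt) auto
qed

text \<open>
  The sphere is covered by rotated copies of one thin patch around a pole. Rotations in the planes
  spanned by \<open>e\<^sub>i\<close> and \<open>e\<^sub>l\<close>, through multiples of an angle of order \<open>w i\<close>, make one coordinate after
  the other small. A rotation in the plane of \<open>e\<^sub>i\<close> and \<open>e\<^sub>l\<close> leaves all other coordinates alone, so
  what has been achieved for earlier coordinates persists, however different the sizes \<open>w i\<close> are.
  Cells of a coordinate chart would not do: they are oblique to the tangent spaces, and the tangential
  error, quadratic in the longest side, can exceed the shortest side.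
\<close>
lemma rotations_to_axis:
  fixes w :: "'n::finite \<Rightarrow> real"
  assumes J: "finite J" "l \<notin> J" and w: "\<forall>i\<in>J. 0 < w i \<and> w i \<le> 1"
  shows "\<exists>G. finite G \<and> real (card G) \<le> (\<Prod>i\<in>J. 20 / w i) \<and> (\<forall>g\<in>G. orthogonal_transformation g) \<and>
    (\<forall>x::real ^ 'n. norm x = 1 \<longrightarrow> (\<exists>g\<in>G. \<exists>y. x = g y \<and> (\<forall>i\<in>J. \<bar>y $ i\<bar> \<le> w i / 3) \<and> (J = {} \<or> 0 \<le> y $ l)))"
  using assms
proof (induction J rule: finite_induct)
  case empty
  show ?case by (intro exI[of _ "{id}"]) (auto simp: orthogonal_transformation_id)
next
  case (insert i J)
  then obtain G where G: "finite G" "real (card G) \<le> (\<Prod>i\<in>J. 20 / w i)" "\<And>g. g \<in> G \<Longrightarrow> orthogonal_transformation g"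
     "\<And>x::real ^ 'n. norm x = 1 \<Longrightarrow> \<exists>g\<in>G. \<exists>y. x = g y \<and> (\<forall>i\<in>J. \<bar>y $ i\<bar> \<le> w i / 3)"
    by (auto; metis)
  have il: "i \<noteq> l" and wi: "0 < w i" "w i \<le> 1" using insert.prems by auto
  define h where "h = w i / 3"
  have h: "0 < h" "h \<le> pi / 2" using wi pi_gt3 by (simp_all add: h_def)
  define K where "K = {k::nat. real k * h \<le> 2 * pi}"
  have KM: "K \<subseteq> {..nat \<lfloor>2 * pi / h\<rfloor>}"
    using h by (auto simp: K_def pos_le_divide_eq intro!: le_nat_floor)
  then have finK: "finite K" by (rule finite_subset) simp
  have "real (card K) \<le> real (Suc (nat \<lfloor>2 * pi / h\<rfloor>))"
    using card_mono[OF _ KM] by (simp del: of_nat_Suc)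
  also have "\<dots> = 1 + of_int \<lfloor>2 * pi / h\<rfloor>"
    using h by (simp add: of_nat_nat)
  also have "\<dots> \<le> 1 + 2 * pi / h" by simp
  \<comment> \<open>the angle step is \<open>w i / 3\<close>, and \<open>1 + 6 \<pi> / w \<le> 20 / w\<close> for \<open>w \<le> 1\<close>\<close>
  also have "\<dots> = 1 + 6 * pi / w i" by (simp add: h_def)
  also have "\<dots> \<le> 20 / w i"
  proof -
    have "pi \<le> 19 / 6" using pi_approx by simp
    then have "w i + 6 * pi \<le> 20" using wi by simp
    then have "(w i + 6 * pi) / w i \<le> 20 / w i" using wi by (intro divide_right_mono) auto
    then show ?thesis using wi by (simp add: add_divide_distrib)
  qed
  finally have cardK: "real (card K) \<le> 20 / w i" .
  define R where "R = (\<lambda>k::nat. plane_rotation i l (real k * h))"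
  have orthR: "orthogonal_transformation (R k)" for k
    unfolding R_def by (rule orthogonal_plane_rotation[OF il])
  define G' where "G' = (\<lambda>(g, k). g \<circ> inv (R k)) ` (G \<times> K)"
  show ?case
  proof (intro exI[of _ G'] conjI ballI allI impI)
    show "finite G'" using G(1) finK by (simp add: G'_def)
    have "card G' \<le> card G * card K"
      unfolding G'_def using G(1) finK card_image_le[of "G \<times> K"] by (simp add: card_cartesian_product)
    then have "real (card G') \<le> real (card G) * real (card K)" by (simp flip: of_nat_mult)
    also have "\<dots> \<le> (\<Prod>i\<in>J. 20 / w i) * (20 / w i)"
      using G(2) cardK insert.prems by (intro mult_mono) (auto intro!: prod_nonneg intro: less_imp_le)
    also have "\<dots> = (\<Prod>i\<in>insert i J. 20 / w i)" using insert.hyps by simp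
    finally show "real (card G') \<le> (\<Prod>i\<in>insert i J. 20 / w i)" .
  next
    fix g assume "g \<in> G'"
    then show "orthogonal_transformation g"
      using G(3) orthR by (auto simp: G'_def intro!: orthogonal_transformation_compose orthogonal_transformation_inv)
  next
    fix x :: "real ^ 'n" assume x: "norm x = 1"
    then obtain g y where g: "g \<in> G" "x = g y" "\<And>j. j \<in> J \<Longrightarrow> \<bar>y $ j\<bar> \<le> w j / 3" using G(4) by blast
    have ny: "norm y = 1" using x g G(3) by (simp add: orthogonal_transformation_norm)
    obtain k :: nat where k: "real k * h \<le> 2 * pi"
      "\<bar>cos (k * h) * y $ i - sin (k * h) * y $ l\<bar> \<le> h * sqrt ((y $ i)\<^sup>2 + (y $ l)\<^sup>2)"
      "0 \<le> sin (k * h) * y $ i + cos (k * h) * y $ l"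
      using rotate_to_axis[OF h] by metis
    define z where "z = R k y"
    have "inv (R k) z = y" unfolding z_def by (rule inv_f_f[OF orthogonal_transformation_inj[OF orthR]])
    then have "x = (g \<circ> inv (R k)) z" using g by simp
    moreover have "g \<circ> inv (R k) \<in> G'" using g(1) k(1) by (auto simp: G'_def K_def)
    moreover have "\<bar>z $ j\<bar> \<le> w j / 3" if "j \<in> insert i J" for j
    proof (cases "j = i")
      case True
      have "h * sqrt ((y $ i)\<^sup>2 + (y $ l)\<^sup>2) \<le> h * 1"
        using sqrt_two_coords_le_norm[OF il, of y] ny h by (intro mult_left_mono) auto
      then show ?thesis using True k(2) by (simp add: z_def R_def plane_rotation_def h_def)
    next
      case False
      then have "j \<in> J" "j \<noteq> l" using that insert.prems by auto
      then show ?thesis using False g(3)[of j] by (simp add: z_def R_def plane_rotation_def)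
    qed
    moreover have "0 \<le> z $ l" using il k(3) by (simp add: z_def R_def plane_rotation_def)
    ultimately show "\<exists>g\<in>G'. \<exists>y. x = g y \<and> (\<forall>i\<in>insert i J. \<bar>y $ i\<bar> \<le> w i / 3) \<and> (insert i J = {} \<or> 0 \<le> y $ l)"
      by blast
  qed
qed

lemma cover_number_le:
  assumes "finite \<B>" "F \<subseteq> \<Union>\<B>" "\<And>B. B \<in> \<B> \<Longrightarrow> \<exists>l. open_box_with_sides B l \<and> (\<forall>i. l $ i \<le> \<delta> $ i)"
  shows "cover_number F \<delta> \<le> card \<B>"
  unfolding cover_number_def using assms by (intro Least_le) blast

text \<open>
  On the patch where the coordinates other than the \<open>l\<close>-th are at most \<open>w\<^sub>i / 3\<close>, the \<open>l\<close>-th one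
  lies within \<open>\<Sum> w\<^sub>i\<^sup>2\<close> of 1; cutting this range into overlapping intervals of length \<open>w\<^sub>l\<close> gives the
  last factor of the bound. The coordinate \<open>l\<close>, the last one, is the normal direction.
\<close>
lemma sphere_box_cover:
  fixes \<delta> w :: "real ^ 'n::{finite,linorder}"
  assumes w: "\<And>i. 0 < w $ i" "\<forall>i j. i \<le> j \<longrightarrow> w $ j \<le> w $ i" "\<And>i. w $ i \<le> \<delta> $ i" "\<And>i. w $ i \<le> 1"
    and l: "\<And>i. i \<le> l" and n: "CARD('n) \<ge> 2"
  shows "\<exists>\<B>. finite \<B> \<and> sphere 0 1 \<subseteq> \<Union>\<B> \<and> (\<forall>B\<in>\<B>. \<exists>l. open_box_with_sides B l \<and> (\<forall>i. l $ i \<le> \<delta> $ i)) \<and>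
    real (card \<B>) \<le> (\<Prod>i\<in>UNIV - {l}. 20 / w $ i) * (1 + 2 * (\<Sum>i\<in>UNIV - {l}. (w $ i)\<^sup>2) / w $ l)"
proof -
  define J where "J = UNIV - {l}"
  have Jne: "J \<noteq> {}"
  proof
    assume "J = {}"
    then have "(UNIV::'n set) = {l}" by (auto simp: J_def)
    then have "CARD('n) = 1" by (metis card_1_singleton_iff One_nat_def)
    then show False using n by simp
  qed
  have "finite J" "l \<notin> J" "\<forall>i\<in>J. 0 < w $ i \<and> w $ i \<le> 1" using w by (auto simp: J_def)
  from rotations_to_axis[of J l "\<lambda>i. w $ i", OF this] obtain G where
    G: "finite G" "real (card G) \<le> (\<Prod>i\<in>J. 20 / w $ i)" and
    orth: "\<forall>g\<in>G. orthogonal_transformation g" and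
    ex: "\<forall>x::real ^ 'n::{finite,linorder}. norm x = 1 \<longrightarrow>
       (\<exists>g\<in>G. \<exists>y. x = g y \<and> (\<forall>i\<in>J. \<bar>y $ i\<bar> \<le> w $ i / 3) \<and> (J = {} \<or> 0 \<le> y $ l))"
    by (elim exE conjE)
  define D where "D = (\<Sum>i\<in>J. (w $ i)\<^sup>2)"
  have D: "D \<ge> 0" by (simp add: D_def sum_nonneg)
  define M where "M = nat \<lfloor>2 * D / w $ l\<rfloor>"
  \<comment> \<open>lower corners of the slices; consecutive slices are shifted by half a side, so that the open
     boxes leave no gap\<close>
  define q :: "nat \<Rightarrow> real ^ 'n::{finite,linorder}" where "q k = (\<chi> i. if i = l then 1 - (real k + 1) * w $ l / 2 else - w $ i / 2)" for k
  define Bx where "Bx = (\<lambda>(g :: real ^ 'n::{finite,linorder} \<Rightarrow> real ^ 'n::{finite,linorder}, k). (\<lambda>x. g (q k) + g x) ` box 0 w)"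
  define \<B> where "\<B> = Bx ` (G \<times> {..M})"
  show ?thesis
  proof (intro exI[of _ \<B>] conjI ballI)
    show "finite \<B>" using G(1) by (simp add: \<B>_def)
    have "card \<B> \<le> card G * Suc M"
      unfolding \<B>_def using G(1) card_image_le[of "G \<times> {..M}" Bx] by (simp add: card_cartesian_product)
    then have "real (card \<B>) \<le> real (card G) * (1 + real M)" by (simp flip: of_nat_mult of_nat_Suc)
    also have "\<dots> \<le> (\<Prod>i\<in>J. 20 / w $ i) * (1 + 2 * D / w $ l)"
    proof (rule mult_mono[OF G(2)])
      have "0 \<le> 2 * D / w $ l" using D w(1)[of l] by simp
      then show "1 + real M \<le> 1 + 2 * D / w $ l" by (simp add: M_def of_nat_nat)
      show "0 \<le> (\<Prod>i\<in>J. 20 / w $ i)" using w(1) by (intro prod_nonneg) (simp add: less_imp_le)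
    qed simp
    finally show "real (card \<B>) \<le> (\<Prod>i\<in>UNIV - {l}. 20 / w $ i) * (1 + 2 * (\<Sum>i\<in>UNIV - {l}. (w $ i)\<^sup>2) / w $ l)"
      by (simp add: J_def D_def)
  next
    fix B assume "B \<in> \<B>"
    then obtain g k where "g \<in> G" "B = (\<lambda>x. g (q k) + g x) ` box 0 w" by (auto simp: \<B>_def Bx_def)
    then have "open_box_with_sides B w" unfolding open_box_with_sides_def using w orth by blast
    then show "\<exists>l. open_box_with_sides B l \<and> (\<forall>i. l $ i \<le> \<delta> $ i)" using w by blast
  next
    show "sphere 0 1 \<subseteq> \<Union>\<B>"
    proof
      fix x :: "real ^ 'n::{finite,linorder}" assume "x \<in> sphere 0 1"
      then have x: "norm x = 1" by simp
      then obtain g y where g: "g \<in> G" "x = g y" and y: "\<And>i. i \<in> J \<Longrightarrow> \<bar>y $ i\<bar> \<le> w $ i / 3" "0 \<le> y $ l"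
        using ex Jne by blast
      define u where "u = 1 - y $ l"
      have ny: "norm y = 1" using x g orth by (simp add: orthogonal_transformation_norm)
      have "(norm y)\<^sup>2 = (y $ l)\<^sup>2 + (\<Sum>i\<in>J. (y $ i)\<^sup>2)"
        unfolding power2_norm_eq_inner inner_vec_def J_def
        by (subst sum.remove[of UNIV l]) (auto simp: power2_eq_square)
      then have yl: "(y $ l)\<^sup>2 = 1 - (\<Sum>i\<in>J. (y $ i)\<^sup>2)" using ny by simp
      have "(\<Sum>i\<in>J. (y $ i)\<^sup>2) \<le> D" unfolding D_def
      proof (rule sum_mono)
        fix i assume "i \<in> J"
        then have "\<bar>y $ i\<bar> \<le> \<bar>w $ i\<bar>" using y(1)[of i] w(1)[of i] by simp
        then show "(y $ i)\<^sup>2 \<le> (w $ i)\<^sup>2" by (simp add: abs_le_square_iff)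
      qed
      moreover have yl1: "y $ l \<le> 1" using component_le_norm_cart[of y l] ny by simp
      moreover have "(y $ l)\<^sup>2 \<le> y $ l"
        using mult_left_le[OF yl1 y(2)] by (simp add: power2_eq_square)
      ultimately have u: "0 \<le> u" "u \<le> D" using yl by (auto simp: u_def)
      define k where "k = nat \<lfloor>2 * u / w $ l\<rfloor>"
      have wl: "w $ l > 0" by (rule w)
      have kM: "k \<le> M" unfolding k_def M_def using u wl by (intro nat_mono floor_mono divide_right_mono) auto
      have kr: "real k = of_int \<lfloor>2 * u / w $ l\<rfloor>" using u wl by (simp add: k_def)
      have k1: "real k * w $ l \<le> 2 * u" and k2: "2 * u < (real k + 1) * w $ l"
        using floor_divide_lower[OF wl, of "2 * u"] floor_divide_upper[OF wl, of "2 * u"] by (simp_all add: kr)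
      have "y - q k \<in> box 0 w"
        unfolding mem_box_cart
      proof
        fix i
        show "0 $ i < (y - q k) $ i \<and> (y - q k) $ i < w $ i"
        proof (cases "i = l")
          case True
          then show ?thesis using k1 k2 wl by (simp add: q_def u_def algebra_simps add_divide_distrib)
        next
          case False
          then have "i \<in> J" by (simp add: J_def)
          then have "\<bar>y $ i\<bar> \<le> w $ i / 3" by (rule y(1))
          then have "- (w $ i / 2) < y $ i" "y $ i < w $ i / 2" using w(1)[of i] by linarith+
          then show ?thesis using False by (simp add: q_def)
        qed
      qed
      moreover have "x = g (q k) + g (y - q k)"
        using linear_add[OF orthogonal_transformation_linear[OF bspec[OF orth g(1)]], of "q k" "y - q k"] g(2) by simp
      ultimately have "x \<in> Bx (g, k)" by (auto simp: Bx_def)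
      then show "x \<in> \<Union>\<B>" using g(1) kM by (auto simp: \<B>_def)
    qed
  qed
qed

section \<open>The volume of a thin shell inside a box\<close>

text \<open>
  By Vitali's covering theorem an open set is, up to a null set, a countable disjoint union of balls.
  An orthogonal transformation maps balls to balls of the same radius and, being an isometry, null
  sets to null sets.
\<close>
lemma emeasure_orthogonal_image_le:
  fixes f :: "'a::euclidean_space \<Rightarrow> 'a"
  assumes f: "orthogonal_transformation f" and U: "open U"
  shows "emeasure lborel (f ` U) \<le> emeasure lborel U"
proof -
  define K where "K = {(c, r). 0 < r \<and> r \<le> 1 \<and> ball c r \<subseteq> U}"
  obtain C where C: "countable C" "C \<subseteq> K" "pairwise (\<lambda>i j. disjnt (ball (fst i) (snd i)) (ball (fst j) (snd j))) C"
     "negligible (U - (\<Union>i\<in>C. ball (fst i) (snd i)))"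
  proof (rule Vitali_covering_theorem_balls[of U K fst snd])
    fix x d assume x: "x \<in> U" "0 < (d::real)"
    then obtain e where e: "e > 0" "ball x e \<subseteq> U" using U openE by blast
    define r where "r = min (min e 1) (d / 2)"
    have "(x, r) \<in> K" using e x by (auto simp: K_def r_def)
    moreover have "0 < r" "r < d" using e x by (auto simp: r_def)
    ultimately show "\<exists>i. i \<in> K \<and> x \<in> ball (fst i) (snd i) \<and> snd i < d"
      by (intro exI[of _ "(x, r)"]) auto
  qed auto
  let ?W = "\<Union>i\<in>C. ball (fst i) (snd i)"
  have lin: "linear f" using f by (rule orthogonal_transformation_linear)
  have im: "f ` ball c r = ball (f c) r" for c r using f by (rule image_orthogonal_transformation_ball)
  have disj: "disjoint_family_on (\<lambda>i. ball (fst i) (snd i)) C"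
    using C(3) by (auto simp: disjoint_family_on_def pairwise_def disjnt_def)
  have neg: "f ` (U - ?W) \<in> null_sets lebesgue"
  proof -
    have "negligible (f ` (U - ?W))"
    proof (rule negligible_locally_Lipschitz_image[OF _ C(4)])
      fix x
      show "\<exists>T B. open T \<and> x \<in> T \<and> (\<forall>y\<in>(U - ?W) \<inter> T. norm (f y - f x) \<le> B * norm (y - x))"
        using orthogonal_transformation_norm[OF f] linear_diff[OF lin]
        by (intro exI[of _ UNIV] exI[of _ 1]) (simp flip: linear_diff[OF lin])
    qed simp
    then show ?thesis by (simp add: negligible_iff_null_sets)
  qed
  have bor: "f ` ?W \<in> sets borel" by (auto simp: image_UN im intro!: borel_open)
  have fU: "f ` U \<in> sets borel"
    using orthogonal_transformation_surj[OF f] lin U by (intro borel_open open_surjective_linear_image) auto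
  have "f ` U \<subseteq> f ` ?W \<union> f ` (U - ?W)" by auto
  then have "emeasure lebesgue (f ` U) \<le> emeasure lebesgue (f ` ?W \<union> f ` (U - ?W))"
    using bor neg by (intro emeasure_mono) auto
  also have "\<dots> = emeasure lebesgue (f ` ?W)"
    using bor neg by (intro emeasure_Un_null_set) auto
  finally have "emeasure lborel (f ` U) \<le> emeasure lborel (f ` ?W)"
    using bor fU by simp
  also have "\<dots> = (\<integral>\<^sup>+i. emeasure lborel (ball (f (fst i)) (snd i)) \<partial>count_space C)"
  proof -
    have "disjoint_family_on (\<lambda>i. f ` ball (fst i) (snd i)) C"
      using disj image_Int[OF orthogonal_transformation_inj[OF f]]
      unfolding disjoint_family_on_def by (metis image_empty)
    then show ?thesis
      unfolding image_UN im by (intro emeasure_UN_countable) (use C(1) in auto)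
  qed
  also have "\<dots> = (\<integral>\<^sup>+i. emeasure lborel (ball (fst i) (snd i)) \<partial>count_space C)"
    using C(2) by (intro nn_integral_cong) (auto simp: K_def emeasure_ball)
  also have "\<dots> = emeasure lborel ?W"
    by (rule emeasure_UN_countable[symmetric]) (use C(1) disj in auto)
  also have "\<dots> \<le> emeasure lborel U"
  proof (rule emeasure_mono)
    show "?W \<subseteq> U"
    proof (rule UN_least)
      fix i assume "i \<in> C"
      with C(2) have "i \<in> K" by blast
      then show "ball (fst i) (snd i) \<subseteq> U" by (simp add: K_def case_prod_unfold)
    qed
  qed (use U in simp)
  finally show ?thesis .
qed

lemma emeasure_square_between_le:
  fixes v \<kappa> :: real
  assumes "\<kappa> \<ge> 0"
  shows "emeasure lborel {s. v \<le> s\<^sup>2 \<and> s\<^sup>2 \<le> v + \<kappa>} \<le> ennreal (2 * sqrt \<kappa>)"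
proof -
  define q where "q = sqrt (max v 0)"
  have "{s. v \<le> s\<^sup>2 \<and> s\<^sup>2 \<le> v + \<kappa>} \<subseteq> {q..q + sqrt \<kappa>} \<union> {- q - sqrt \<kappa>..- q}"
  proof
    fix s assume "s \<in> {s. v \<le> s\<^sup>2 \<and> s\<^sup>2 \<le> v + \<kappa>}"
    then have s: "max v 0 \<le> s\<^sup>2" "s\<^sup>2 \<le> max v 0 + \<kappa>" by auto
    have "q \<le> \<bar>s\<bar>" using real_sqrt_le_mono[OF s(1)] by (simp add: q_def)
    moreover have "\<bar>s\<bar> \<le> sqrt (max v 0 + \<kappa>)" using real_sqrt_le_mono[OF s(2)] by simp
    then have "\<bar>s\<bar> \<le> q + sqrt \<kappa>"
      using sqrt_add_le_add_sqrt[of "max v 0" \<kappa>] assms by (simp add: q_def)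
    ultimately show "s \<in> {q..q + sqrt \<kappa>} \<union> {- q - sqrt \<kappa>..- q}" by auto
  qed
  then have "emeasure lborel {s. v \<le> s\<^sup>2 \<and> s\<^sup>2 \<le> v + \<kappa>} \<le> emeasure lborel ({q..q + sqrt \<kappa>} \<union> {- q - sqrt \<kappa>..- q})"
    by (rule emeasure_mono) auto
  also have "\<dots> \<le> emeasure lborel {q..q + sqrt \<kappa>} + emeasure lborel {- q - sqrt \<kappa>..- q}"
    by (rule emeasure_subadditive) auto
  also have "\<dots> = ennreal (2 * sqrt \<kappa>)" using assms by (simp flip: ennreal_plus)
  finally show ?thesis .
qed

lemma emeasure_annulus_le:
  fixes v \<kappa> :: real
  assumes "\<kappa> \<ge> 0"
  shows "emeasure lborel {z::real \<times> real. v \<le> (fst z)\<^sup>2 + (snd z)\<^sup>2 \<and> (fst z)\<^sup>2 + (snd z)\<^sup>2 \<le> v + \<kappa>} \<le> ennreal (pi * \<kappa>)"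
    (is "emeasure lborel ?E \<le> _")
proof -
  have nrm: "norm z = sqrt ((fst z)\<^sup>2 + (snd z)\<^sup>2)" for z :: "real \<times> real" by (simp add: norm_prod_def)
  have vol: "unit_ball_vol (DIM(real \<times> real)) = pi" by (simp add: unit_ball_vol_2)
  show ?thesis
  proof (cases "v \<ge> 0")
    case True
    have E: "?E \<subseteq> cball 0 (sqrt (v + \<kappa>)) - ball 0 (sqrt v)"
      by (auto simp: nrm not_less)
    have "emeasure lborel ?E \<le> emeasure lborel (cball 0 (sqrt (v + \<kappa>)) - ball 0 (sqrt v) :: (real \<times> real) set)"
      by (rule emeasure_mono[OF E]) auto
    also have "\<dots> = emeasure lborel (cball 0 (sqrt (v + \<kappa>)) :: (real \<times> real) set) - emeasure lborel (ball 0 (sqrt v) :: (real \<times> real) set)"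
    proof (rule emeasure_Diff)
      have "sqrt v \<le> sqrt (v + \<kappa>)" using assms by simp
      then show "ball 0 (sqrt v) \<subseteq> (cball 0 (sqrt (v + \<kappa>)) :: (real \<times> real) set)"
        by (intro order.trans[OF ball_subset_cball subset_cball])
    qed (use True in \<open>auto simp: emeasure_ball\<close>)
    also have "\<dots> = ennreal (pi * (v + \<kappa>)) - ennreal (pi * v)"
      using True assms vol by (simp add: emeasure_ball emeasure_cball)
    also have "\<dots> = ennreal (pi * \<kappa>)"
      using True by (simp add: ennreal_minus algebra_simps)
    finally show ?thesis .
  next
    case False
    have "?E \<subseteq> cball 0 (sqrt \<kappa>)" using False by (auto simp: nrm)
    then have "emeasure lborel ?E \<le> emeasure lborel (cball 0 (sqrt \<kappa>) :: (real \<times> real) set)"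
      by (rule emeasure_mono) auto
    also have "\<dots> = ennreal (pi * \<kappa>)" using assms vol by (simp add: emeasure_cball)
    finally show ?thesis .
  qed
qed

text \<open>
  The three bounds for the area of the part of a thin annulus in a rectangle: the area of the
  rectangle; the largest length of a horizontal slice of the annulus times the height of the
  rectangle; the area of the whole annulus. In the end they yield the three exponents of the sphere.
\<close>
lemma nn_integral_annulus_section_le:
  fixes v \<kappa> :: real
  assumes "\<kappa> \<ge> 0" "a1 \<le> b1" "a2 \<le> b2"
  defines "E \<equiv> \<lambda>t s. s \<in> {a1<..<b1} \<and> t \<in> {a2<..<b2} \<and> v \<le> t\<^sup>2 + s\<^sup>2 \<and> t\<^sup>2 + s\<^sup>2 \<le> v + \<kappa>"
  shows "(\<integral>\<^sup>+t. \<integral>\<^sup>+s. of_bool (E t s) \<partial>lborel \<partial>lborel)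
    \<le> ennreal (min ((b1 - a1) * (b2 - a2)) (min (2 * sqrt \<kappa> * (b2 - a2)) (pi * \<kappa>)))"
proof -
  let ?I = "\<integral>\<^sup>+t. \<integral>\<^sup>+s. of_bool (E t s) \<partial>lborel \<partial>lborel"
  have slab: "?I \<le> ennreal (L * (b2 - a2))" if L: "L \<ge> 0" "\<And>t. (\<integral>\<^sup>+s. of_bool (E t s) \<partial>lborel) \<le> ennreal L" for L
  proof -
    have "?I \<le> (\<integral>\<^sup>+t. ennreal L * indicator {a2<..<b2} t \<partial>lborel)"
    proof (rule nn_integral_mono)
      fix t
      show "(\<integral>\<^sup>+s. of_bool (E t s) \<partial>lborel) \<le> ennreal L * indicator {a2<..<b2} t"
      proof (cases "t \<in> {a2<..<b2}")
        case True
        then show ?thesis using L(2)[of t] by simp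
      next
        case False
        then have "\<not> E t s" for s by (auto simp: E_def)
        then show ?thesis by simp
      qed
    qed
    also have "\<dots> = ennreal (L * (b2 - a2))"
      using L assms by (simp add: nn_integral_cmult_indicator ennreal_mult)
    finally show ?thesis .
  qed
  have 1: "?I \<le> ennreal ((b1 - a1) * (b2 - a2))"
  proof (rule slab)
    fix t
    have "(\<integral>\<^sup>+s. of_bool (E t s) \<partial>lborel) \<le> (\<integral>\<^sup>+s. indicator {a1<..<b1} s \<partial>lborel)"
      by (intro nn_integral_mono) (auto simp: E_def split: split_indicator)
    then show "(\<integral>\<^sup>+s. of_bool (E t s) \<partial>lborel) \<le> ennreal (b1 - a1)" using assms by simp
  qed (use assms in simp)
  have 2: "?I \<le> ennreal (2 * sqrt \<kappa> * (b2 - a2))"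
  proof (rule slab)
    fix t
    have "(\<integral>\<^sup>+s. of_bool (E t s) \<partial>lborel) \<le> (\<integral>\<^sup>+s. indicator {s. v - t\<^sup>2 \<le> s\<^sup>2 \<and> s\<^sup>2 \<le> v - t\<^sup>2 + \<kappa>} s \<partial>lborel)"
      by (intro nn_integral_mono) (auto simp: E_def split: split_indicator)
    also have "\<dots> = emeasure lborel {s. v - t\<^sup>2 \<le> s\<^sup>2 \<and> s\<^sup>2 \<le> v - t\<^sup>2 + \<kappa>}"
      by (rule nn_integral_indicator) measurable
    also have "\<dots> \<le> ennreal (2 * sqrt \<kappa>)" by (rule emeasure_square_between_le[OF assms(1)])
    finally show "(\<integral>\<^sup>+s. of_bool (E t s) \<partial>lborel) \<le> ennreal (2 * sqrt \<kappa>)" .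
  qed (use assms in simp)
  have 3: "?I \<le> ennreal (pi * \<kappa>)"
  proof -
    let ?E = "{z::real \<times> real. v \<le> (fst z)\<^sup>2 + (snd z)\<^sup>2 \<and> (fst z)\<^sup>2 + (snd z)\<^sup>2 \<le> v + \<kappa>}"
    have E: "?E \<in> sets (lborel \<Otimes>\<^sub>M lborel)"
      unfolding lborel_prod sets_lborel
      by (intro borel_closed closed_Collect_conj closed_Collect_le continuous_intros)
    have "?I \<le> (\<integral>\<^sup>+t. \<integral>\<^sup>+s. indicator ?E (t, s) \<partial>lborel \<partial>lborel)"
      by (intro nn_integral_mono) (auto simp: E_def split: split_indicator)
    also have "\<dots> = emeasure (lborel \<Otimes>\<^sub>M lborel) ?E"
      by (rule lborel.emeasure_pair_measure[OF E, symmetric])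
    also have "\<dots> \<le> ennreal (pi * \<kappa>)"
      unfolding lborel_prod by (rule emeasure_annulus_le[OF assms(1)])
    finally show ?thesis .
  qed
  show ?thesis using 1 2 3 by (simp add: min_def)
qed

text \<open>
  Fubini: two coordinates are integrated first, over the sections, and the other ones range over
  intervals.
\<close>
lemma emeasure_le_two_coord_sections:
  fixes A :: "'a::euclidean_space set"
  assumes A: "A \<in> sets borel" "A \<subseteq> box a b"
    and uv: "u \<in> Basis" "v \<in> Basis" "u \<noteq> v"
    and ab: "\<And>i. i \<in> Basis \<Longrightarrow> a \<bullet> i \<le> b \<bullet> i"
    and K: "K \<ge> 0"
    and sec: "\<And>y. y \<bullet> u = 0 \<Longrightarrow> y \<bullet> v = 0 \<Longrightarrow>
      (\<integral>\<^sup>+t. \<integral>\<^sup>+s. indicator A (y + t *\<^sub>R v + s *\<^sub>R u) \<partial>lborel \<partial>lborel) \<le> ennreal K"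
  shows "emeasure lborel A \<le> ennreal (K * (\<Prod>i\<in>Basis - {u, v}. (b - a) \<bullet> i))"
proof -
  interpret product_sigma_finite "\<lambda>_::'a. lborel :: real measure" by standard
  define I where "I = Basis - {u, v}"
  have I: "finite I" "v \<notin> I" "u \<notin> insert v I" "finite (insert v I)" and Basis: "(Basis :: 'a set) = insert u (insert v I)"
    using uv by (auto simp: I_def)
  define P where "P x = (\<Sum>i\<in>Basis. x i *\<^sub>R i)" for x :: "'a \<Rightarrow> real"
  have P_meas [measurable]: "P \<in> borel_measurable (\<Pi>\<^sub>M i\<in>Basis. lborel)"
    unfolding P_def by measurable
  note A(1)[measurable]
  have P_upd: "P ((x(v := t))(u := s)) = (\<Sum>i\<in>I. x i *\<^sub>R i) + t *\<^sub>R v + s *\<^sub>R u" for x t s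
  proof -
    have "(\<Sum>i\<in>I. ((x(v := t))(u := s)) i *\<^sub>R i) = (\<Sum>i\<in>I. x i *\<^sub>R i)"
      using I by (intro sum.cong) auto
    then show ?thesis unfolding P_def Basis using I uv by (simp add: algebra_simps)
  qed
  have ind_meas: "(\<lambda>x. indicator A (P x) :: ennreal) \<in> borel_measurable (Pi\<^sub>M (insert u (insert v I)) (\<lambda>_. lborel))"
    unfolding Basis[symmetric] by measurable
  have "emeasure lborel A = (\<integral>\<^sup>+x. indicator A x \<partial>lborel)"
    using A by simp
  also have "\<dots> = (\<integral>\<^sup>+x. indicator A (P x) \<partial>(\<Pi>\<^sub>M i\<in>Basis. lborel))"
    by (subst lborel_eq, subst nn_integral_distr) (simp_all add: P_def)
  also have "\<dots> = (\<integral>\<^sup>+x. \<integral>\<^sup>+s. indicator A (P (x(u := s))) \<partial>lborel \<partial>Pi\<^sub>M (insert v I) (\<lambda>_. lborel))"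
    unfolding Basis by (rule product_nn_integral_insert[OF I(4,3) ind_meas])
  also have "\<dots> = (\<integral>\<^sup>+x. \<integral>\<^sup>+t. \<integral>\<^sup>+s. indicator A (P ((x(v := t))(u := s))) \<partial>lborel \<partial>lborel \<partial>Pi\<^sub>M I (\<lambda>_. lborel))"
  proof (rule product_nn_integral_insert[OF I(1,2)])
    have "(\<lambda>(x, s). indicator A (P (x(u := s))) :: ennreal) \<in> borel_measurable (Pi\<^sub>M (insert v I) (\<lambda>_. lborel) \<Otimes>\<^sub>M lborel)"
      using measurable_compose[OF measurable_add_dim[of u "insert v I" "\<lambda>_. lborel"] ind_meas]
      by (simp add: case_prod_unfold)
    then show "(\<lambda>x. \<integral>\<^sup>+s. indicator A (P (x(u := s))) \<partial>lborel) \<in> borel_measurable (Pi\<^sub>M (insert v I) (\<lambda>_. lborel))"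
      by (rule lborel.borel_measurable_nn_integral)
  qed
  also have "\<dots> \<le> (\<integral>\<^sup>+x. ennreal K * (\<Prod>i\<in>I. indicator {a \<bullet> i<..<b \<bullet> i} (x i)) \<partial>Pi\<^sub>M I (\<lambda>_. lborel))"
  proof (rule nn_integral_mono)
    fix x :: "'a \<Rightarrow> real"
    let ?y = "\<Sum>i\<in>I. x i *\<^sub>R i"
    have yi: "?y \<bullet> j = (if j \<in> I then x j else 0)" if "j \<in> Basis" for j
    proof -
      have "?y \<bullet> j = (\<Sum>i\<in>I. if i = j then x j else 0)"
        unfolding inner_sum_left using that by (intro sum.cong) (auto simp: I_def inner_Basis)
      then show ?thesis using I(1) by simp
    qed
    let ?S = "\<integral>\<^sup>+t. \<integral>\<^sup>+s. indicator A (?y + t *\<^sub>R v + s *\<^sub>R u) \<partial>lborel \<partial>lborel"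
    show "(\<integral>\<^sup>+t. \<integral>\<^sup>+s. indicator A (P ((x(v := t))(u := s))) \<partial>lborel \<partial>lborel)
       \<le> ennreal K * (\<Prod>i\<in>I. indicator {a \<bullet> i<..<b \<bullet> i} (x i))"
      unfolding P_upd
    proof (cases "\<forall>i\<in>I. x i \<in> {a \<bullet> i<..<b \<bullet> i}")
      case True
      then have "(\<Prod>i\<in>I. indicator {a \<bullet> i<..<b \<bullet> i} (x i) :: ennreal) = 1"
        by (intro prod.neutral) auto
      then show "?S \<le> ennreal K * (\<Prod>i\<in>I. indicator {a \<bullet> i<..<b \<bullet> i} (x i))"
        using sec[of ?y] yi uv by (simp add: I_def)
    next
      case False
      then obtain j where j: "j \<in> I" "x j \<notin> {a \<bullet> j<..<b \<bullet> j}" by blast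
      have "?y + t *\<^sub>R v + s *\<^sub>R u \<notin> A" for t s
      proof
        assume "?y + t *\<^sub>R v + s *\<^sub>R u \<in> A"
        then have "?y + t *\<^sub>R v + s *\<^sub>R u \<in> box a b" using A by blast
        then have "(?y + t *\<^sub>R v + s *\<^sub>R u) \<bullet> j \<in> {a \<bullet> j<..<b \<bullet> j}" using j by (simp add: mem_box I_def)
        moreover have "(?y + t *\<^sub>R v + s *\<^sub>R u) \<bullet> j = x j"
          using j uv yi[of j] by (auto simp: inner_add_left I_def inner_Basis)
        ultimately show False using j by simp
      qed
      then have "?S = 0" by simp
      then show "?S \<le> ennreal K * (\<Prod>i\<in>I. indicator {a \<bullet> i<..<b \<bullet> i} (x i))" by simp
    qed
  qed
  also have "\<dots> = ennreal K * (\<integral>\<^sup>+x. (\<Prod>i\<in>I. indicator {a \<bullet> i<..<b \<bullet> i} (x i)) \<partial>Pi\<^sub>M I (\<lambda>_. lborel))"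
    by (rule nn_integral_cmult) measurable
  also have "(\<integral>\<^sup>+x. (\<Prod>i\<in>I. indicator {a \<bullet> i<..<b \<bullet> i} (x i)) \<partial>Pi\<^sub>M I (\<lambda>_. lborel)) = (\<Prod>i\<in>I. ennreal ((b - a) \<bullet> i))"
  proof (subst product_nn_integral_prod[OF I(1)])
    show "(\<Prod>i\<in>I. \<integral>\<^sup>+x. indicator {a \<bullet> i<..<b \<bullet> i} x \<partial>lborel) = (\<Prod>i\<in>I. ennreal ((b - a) \<bullet> i))"
      using ab by (intro prod.cong) (auto simp: I_def inner_diff_left)
  qed auto
  also have "\<dots> = ennreal (\<Prod>i\<in>I. (b - a) \<bullet> i)"
    using ab by (intro prod_ennreal) (auto simp: I_def inner_diff_left)
  also have "ennreal K * \<dots> = ennreal (K * (\<Prod>i\<in>I. (b - a) \<bullet> i))"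
    using K ab by (intro ennreal_mult[symmetric] prod_nonneg) (auto simp: I_def inner_diff_left)
  finally show ?thesis by (simp add: I_def)
qed

lemma emeasure_shell_box_le:
  fixes a b :: "'a::euclidean_space"
  assumes uv: "u \<in> Basis" "v \<in> Basis" "u \<noteq> v"
    and ab: "\<And>i. i \<in> Basis \<Longrightarrow> a \<bullet> i \<le> b \<bullet> i"
    and \<eta>: "0 \<le> \<eta>" "\<eta> \<le> 1"
  shows "emeasure lborel {x \<in> box a b. 1 < norm x \<and> norm x < 1 + \<eta>} \<le>
    ennreal (min (((b - a) \<bullet> u) * ((b - a) \<bullet> v)) (min (2 * sqrt (3 * \<eta>) * ((b - a) \<bullet> v)) (pi * (3 * \<eta>)))
      * (\<Prod>i\<in>Basis - {u, v}. (b - a) \<bullet> i))" (is "emeasure lborel ?A \<le> ennreal (?K * _)")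
proof (rule emeasure_le_two_coord_sections[OF _ _ uv ab])
  have "?A = box a b \<inter> {x. 1 < norm x} \<inter> {x. norm x < 1 + \<eta>}" by auto
  moreover have "open \<dots>" by (intro open_Int open_box open_Collect_less continuous_intros)
  ultimately show "?A \<in> sets borel" by simp
  show "?A \<subseteq> box a b" by auto
  show "0 \<le> ?K" using \<eta> ab uv by (auto simp: inner_diff_left)
  fix y :: 'a assume y: "y \<bullet> u = 0" "y \<bullet> v = 0"
  have orth: "u \<bullet> y = 0" "v \<bullet> y = 0" "u \<bullet> v = 0" "v \<bullet> u = 0" "u \<bullet> u = 1" "v \<bullet> v = 1"
    using y uv by (auto simp: inner_commute[of _ y] inner_Basis)
  let ?E = "\<lambda>t s. s \<in> {a \<bullet> u<..<b \<bullet> u} \<and> t \<in> {a \<bullet> v<..<b \<bullet> v} \<and> 1 - (norm y)\<^sup>2 \<le> t\<^sup>2 + s\<^sup>2 \<and> t\<^sup>2 + s\<^sup>2 \<le> 1 - (norm y)\<^sup>2 + 3 * \<eta>"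
  have sub: "?E t s" if "y + t *\<^sub>R v + s *\<^sub>R u \<in> ?A" for t s
  proof -
    let ?x = "y + t *\<^sub>R v + s *\<^sub>R u"
    have "?x \<bullet> u = s" "?x \<bullet> v = t" using y orth by (simp_all add: inner_add_left)
    then have "s \<in> {a \<bullet> u<..<b \<bullet> u}" "t \<in> {a \<bullet> v<..<b \<bullet> v}" using that uv by (auto simp: mem_box)
    moreover have n: "(norm ?x)\<^sup>2 = (norm y)\<^sup>2 + t\<^sup>2 + s\<^sup>2"
      unfolding power2_norm_eq_inner using y orth
      by (simp add: inner_add_left inner_add_right power2_eq_square)
    have "1\<^sup>2 \<le> (norm ?x)\<^sup>2" "(norm ?x)\<^sup>2 \<le> (1 + \<eta>)\<^sup>2" using that by (auto intro!: power_mono)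
    moreover have "(1 + \<eta>)\<^sup>2 \<le> 1 + 3 * \<eta>"
      using \<eta> mult_left_le[of \<eta> \<eta>] by (simp add: power2_eq_square algebra_simps)
    ultimately show ?thesis using n by auto
  qed
  have "(\<integral>\<^sup>+t. \<integral>\<^sup>+s. indicator ?A (y + t *\<^sub>R v + s *\<^sub>R u) \<partial>lborel \<partial>lborel)
     \<le> (\<integral>\<^sup>+t. \<integral>\<^sup>+s. of_bool (?E t s) \<partial>lborel \<partial>lborel)"
    using sub by (intro nn_integral_mono) (auto split: split_indicator)
  also have "\<dots> \<le> ennreal ?K"
    using nn_integral_annulus_section_le[of "3 * \<eta>" "a \<bullet> u" "b \<bullet> u" "a \<bullet> v" "b \<bullet> v" "1 - (norm y)\<^sup>2"] \<eta> ab uv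
    by (simp add: inner_diff_left)
  finally show "(\<integral>\<^sup>+t. \<integral>\<^sup>+s. indicator ?A (y + t *\<^sub>R v + s *\<^sub>R u) \<partial>lborel \<partial>lborel) \<le> ennreal ?K" .
qed

lemma emeasure_shell_ge:
  assumes "0 < \<eta>"
  shows "ennreal (unit_ball_vol (DIM('a)) * \<eta>) \<le> emeasure lborel {x::'a::euclidean_space. 1 < norm x \<and> norm x < 1 + \<eta>}"
proof -
  let ?V = "unit_ball_vol (DIM('a))"
  have V: "?V \<ge> 0" by simp
  have "{x::'a. 1 < norm x \<and> norm x < 1 + \<eta>} = ball 0 (1 + \<eta>) - cball 0 1" by auto
  also have "emeasure lborel \<dots> = emeasure lborel (ball 0 (1 + \<eta>) :: 'a set) - emeasure lborel (cball 0 1 :: 'a set)"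
    using assms by (intro emeasure_Diff) (auto simp: emeasure_cball)
  also have "emeasure lborel (ball 0 (1 + \<eta>) :: 'a set) - emeasure lborel (cball 0 1 :: 'a set)
     = ennreal (?V * (1 + \<eta>) ^ DIM('a)) - ennreal ?V"
    using assms by (simp add: emeasure_ball emeasure_cball)
  also have "\<dots> = ennreal (?V * (1 + \<eta>) ^ DIM('a) - ?V)" using V by (simp add: ennreal_minus)
  finally have *: "ennreal (?V * (1 + \<eta>) ^ DIM('a) - ?V) = emeasure lborel {x::'a. 1 < norm x \<and> norm x < 1 + \<eta>}" ..
  have "1 + \<eta> \<le> (1 + \<eta>) ^ DIM('a)" using assms by (intro self_le_power) auto
  then have "?V * (1 + \<eta>) \<le> ?V * (1 + \<eta>) ^ DIM('a)" using V by (rule mult_left_mono)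
  then have "ennreal (?V * \<eta>) \<le> ennreal (?V * (1 + \<eta>) ^ DIM('a) - ?V)"
    by (intro ennreal_leI) (simp add: algebra_simps)
  then show ?thesis unfolding * .
qed

section \<open>Covering numbers of the sphere\<close>

text \<open>
  A point of the shell is within \<open>\<eta>\<close> of its radial projection, so if the projection lies in a box
  with sides at most \<open>\<delta>\<close>, the point itself lies in the box with sides \<open>3 \<delta>\<close>. In the coordinates of
  the box the shell is still a centred shell.
\<close>
lemma shell_box_image_subset:
  fixes \<delta> :: "real ^ 'n::{finite,linorder}"
  assumes B: "open_box_with_sides B l" "\<And>k. l $ k \<le> \<delta> $ k"
    and \<eta>: "0 < \<eta>" "\<And>k. \<eta> \<le> \<delta> $ k"
  obtains f a where "orthogonal_transformation f"
    "{y. 1 < norm y \<and> norm y < 1 + \<eta> \<and> y /\<^sub>R norm y \<in> B}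
       \<subseteq> f ` {x \<in> box a (a + 3 *\<^sub>R \<delta>). 1 < norm x \<and> norm x < 1 + \<eta>}"
proof -
  obtain f c where f: "orthogonal_transformation f" and Bf: "B = (\<lambda>x. c + f x) ` box 0 l"
    using B by (auto simp: open_box_with_sides_def)
  have lin: "linear f" by (rule orthogonal_transformation_linear[OF f])
  obtain p where p: "c = f p" using orthogonal_transformation_surj[OF f] by (metis surjD)
  define a where "a = p - (\<chi> k. \<eta>)"
  have "y \<in> f ` {x \<in> box a (a + 3 *\<^sub>R \<delta>). 1 < norm x \<and> norm x < 1 + \<eta>}"
    if y: "1 < norm y" "norm y < 1 + \<eta>" "y /\<^sub>R norm y \<in> B" for y
  proof -
    obtain x where x: "y = f x" using orthogonal_transformation_surj[OF f] by (metis surjD)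
    have nx: "norm x = norm y" using x by (simp add: orthogonal_transformation_norm[OF f])
    obtain z where z: "z \<in> box 0 l" "y /\<^sub>R norm y = c + f z" using y(3) Bf by auto
    have "f (x /\<^sub>R norm x) = f (p + z)"
      using z(2) by (simp add: nx linear_scale[OF lin] linear_add[OF lin] flip: x p)
    then have xz: "x /\<^sub>R norm x = p + z"
      using orthogonal_transformation_inj[OF f] by (simp add: inj_eq)
    have "x - x /\<^sub>R norm x = (1 - inverse (norm x)) *\<^sub>R x" by (simp add: scaleR_left_diff_distrib)
    then have "norm (x - (p + z)) = \<bar>1 - inverse (norm x)\<bar> * norm x" by (simp flip: xz)
    also have "\<dots> = norm x - 1"
    proof -
      have "norm x \<noteq> 0" "inverse (norm x) \<le> 1" using y nx by (auto simp: inverse_le_1_iff)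
      then show ?thesis by (simp add: left_diff_distrib)
    qed
    also have "\<dots> < \<eta>" using y nx by simp
    finally have d: "\<bar>x $ k - (p $ k + z $ k)\<bar> < \<eta>" for k
      using component_le_norm_cart[of "x - (p + z)" k] by simp
    have "x \<in> box a (a + 3 *\<^sub>R \<delta>)"
      unfolding mem_box_cart
    proof
      fix k
      have "0 < z $ k" "z $ k < l $ k" using z(1) by (auto simp: mem_box_cart)
      then show "a $ k < x $ k \<and> x $ k < (a + 3 *\<^sub>R \<delta>) $ k"
        using d[of k] B(2)[of k] \<eta>(2)[of k] by (simp add: a_def abs_less_iff)
    qed
    then show ?thesis using x y nx by auto
  qed
  then show ?thesis using that[OF f, of a] by blast
qed

lemma prod_Basis_cart_minus_two:
  fixes x :: "real ^ 'n"
  shows "(\<Prod>b\<in>Basis - {axis i 1, axis j 1}. x \<bullet> b) = (\<Prod>k\<in>UNIV - {i, j}. x $ k)"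
proof -
  have "Basis - {axis i 1, axis j 1} = (\<lambda>k. axis k 1 :: real ^ 'n) ` (UNIV - {i, j})"
    by (auto simp: Basis_vec_def axis_eq_axis)
  moreover have "inj_on (\<lambda>k. axis k 1 :: real ^ 'n) (UNIV - {i, j})"
    by (auto simp: inj_on_def axis_eq_axis)
  ultimately show ?thesis by (simp add: prod.reindex inner_axis)
qed

text \<open>
  A cover of the sphere induces a cover of the shell \<open>1 < |y| < 1 + \<eta>\<close>, whose volume is at least
  proportional to \<open>\<eta>\<close>. Working with a shell of positive thickness replaces surface measure by
  Lebesgue measure and treats all positions of a box relative to the sphere at once.
\<close>
lemma card_sphere_cover_ge:
  fixes \<delta> :: "real ^ 'n::{finite,linorder}"
  assumes fin: "finite \<B>" and cov: "sphere 0 1 \<subseteq> \<Union>\<B>"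
    and box: "\<And>B. B \<in> \<B> \<Longrightarrow> \<exists>l. open_box_with_sides B l \<and> (\<forall>k. l $ k \<le> \<delta> $ k)"
    and ij: "i \<noteq> j" and \<eta>: "0 < \<eta>" "\<eta> \<le> 1" "\<And>k. \<eta> \<le> \<delta> $ k"
  shows "unit_ball_vol CARD('n) * \<eta> \<le> real (card \<B>) *
    (min (3 * \<delta> $ i * (3 * \<delta> $ j)) (min (2 * sqrt (3 * \<eta>) * (3 * \<delta> $ j)) (pi * (3 * \<eta>)))
      * (\<Prod>k\<in>UNIV - {i, j}. 3 * \<delta> $ k))" (is "_ \<le> _ * ?M")
proof -
  let ?Sh = "{y :: real ^ 'n::{finite,linorder}. 1 < norm y \<and> norm y < 1 + \<eta>}"
  have \<delta>: "0 < \<delta> $ k" for k using \<eta>(1) \<eta>(3)[of k] by simp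
  have M: "0 \<le> ?M"
    using \<delta> \<eta> by (intro mult_nonneg_nonneg prod_nonneg) (auto intro: less_imp_le)
  have "\<exists>U. U \<in> sets borel \<and> {y. y \<in> ?Sh \<and> y /\<^sub>R norm y \<in> B} \<subseteq> U \<and> emeasure lborel U \<le> ennreal ?M"
    if BB: "B \<in> \<B>" for B
  proof -
    obtain l where l: "open_box_with_sides B l" "\<And>k. l $ k \<le> \<delta> $ k" using box[OF BB] by blast
    obtain f a where f: "orthogonal_transformation f"
      "{y. 1 < norm y \<and> norm y < 1 + \<eta> \<and> y /\<^sub>R norm y \<in> B}
         \<subseteq> f ` {x \<in> box a (a + 3 *\<^sub>R \<delta>). 1 < norm x \<and> norm x < 1 + \<eta>}"
      by (rule shell_box_image_subset[OF l \<eta>(1,3)])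
    let ?A = "{x \<in> box a (a + 3 *\<^sub>R \<delta>). 1 < norm x \<and> norm x < 1 + \<eta>}"
    have "?A = box a (a + 3 *\<^sub>R \<delta>) \<inter> {x. 1 < norm x} \<inter> {x. norm x < 1 + \<eta>}" by auto
    moreover have "open \<dots>" by (intro open_Int open_box open_Collect_less continuous_intros)
    ultimately have oA: "open ?A" by simp
    have "open (f ` ?A)"
      by (rule open_surjective_linear_image[OF oA orthogonal_transformation_linear[OF f(1)]
            orthogonal_transformation_surj[OF f(1)]])
    moreover have "emeasure lborel (f ` ?A) \<le> ennreal ?M"
    proof (rule order.trans[OF emeasure_orthogonal_image_le[OF f(1) oA]])
      have "emeasure lborel ?A \<le> ennreal (min ((3 *\<^sub>R \<delta>) \<bullet> axis i 1 * ((3 *\<^sub>R \<delta>) \<bullet> axis j 1))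
          (min (2 * sqrt (3 * \<eta>) * ((3 *\<^sub>R \<delta>) \<bullet> axis j 1)) (pi * (3 * \<eta>)))
          * (\<Prod>b\<in>Basis - {axis i 1, axis j 1}. (3 *\<^sub>R \<delta>) \<bullet> b))"
      proof (rule order.trans[OF emeasure_shell_box_le[of "axis i 1" "axis j 1"]])
        show "a \<bullet> b \<le> (a + 3 *\<^sub>R \<delta>) \<bullet> b" if "b \<in> Basis" for b
          using that \<delta> by (auto simp: Basis_vec_def inner_axis less_imp_le)
      qed (use ij \<eta> in \<open>auto simp: axis_eq_axis\<close>)
      then show "emeasure lborel ?A \<le> ennreal ?M"
        unfolding prod_Basis_cart_minus_two by (simp add: inner_axis)
    qed
    ultimately show ?thesis using f(2) by (intro exI[of _ "f ` ?A"]) auto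
  qed
  then have "\<forall>B\<in>\<B>. \<exists>U. U \<in> sets borel \<and> {y. y \<in> ?Sh \<and> y /\<^sub>R norm y \<in> B} \<subseteq> U \<and> emeasure lborel U \<le> ennreal ?M"
    by blast
  from bchoice[OF this] obtain U where U: "\<And>B. B \<in> \<B> \<Longrightarrow> U B \<in> sets borel \<and> {y. y \<in> ?Sh \<and> y /\<^sub>R norm y \<in> B} \<subseteq> U B \<and> emeasure lborel (U B) \<le> ennreal ?M"
    by blast
  have sub: "?Sh \<subseteq> (\<Union>B\<in>\<B>. U B)"
  proof
    fix y assume y: "y \<in> ?Sh"
    then have "norm y \<noteq> 0" by auto
    then have "y /\<^sub>R norm y \<in> sphere 0 1" by simp
    then obtain B where "B \<in> \<B>" "y /\<^sub>R norm y \<in> B" using cov by blast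
    then show "y \<in> (\<Union>B\<in>\<B>. U B)" using U[of B] y by blast
  qed
  have "ennreal (unit_ball_vol CARD('n) * \<eta>) \<le> emeasure lborel ?Sh"
    using emeasure_shell_ge[OF \<eta>(1), where 'a = "real ^ 'n::{finite,linorder}"] by simp
  also have "\<dots> \<le> emeasure lborel (\<Union>B\<in>\<B>. U B)"
    using U fin by (intro emeasure_mono sub) auto
  also have "\<dots> \<le> (\<Sum>B\<in>\<B>. emeasure lborel (U B))"
    using U fin by (intro emeasure_subadditive_finite) auto
  also have "\<dots> \<le> (\<Sum>B\<in>\<B>. ennreal ?M)"
    using U by (intro sum_mono) auto
  also have "\<dots> = ennreal (real (card \<B>) * ?M)"
    using M by (simp add: ennreal_mult ennreal_of_nat_eq_real_of_nat)
  finally show ?thesis using M by (subst (asm) ennreal_le_iff) auto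
qed

text \<open>
  The least number defining the covering number is attained only if some finite cover exists.
\<close>
lemma cover_number_attained:
  assumes "finite \<B>" "F \<subseteq> \<Union>\<B>" "\<And>B. B \<in> \<B> \<Longrightarrow> \<exists>l. open_box_with_sides B l \<and> (\<forall>i. l $ i \<le> \<delta> $ i)"
  obtains \<B>' where "finite \<B>'" "card \<B>' = cover_number F \<delta>" "F \<subseteq> \<Union>\<B>'"
    "\<And>B. B \<in> \<B>' \<Longrightarrow> \<exists>l. open_box_with_sides B l \<and> (\<forall>i. l $ i \<le> \<delta> $ i)"
proof -
  let ?P = "\<lambda>k. \<exists>\<B>. finite \<B> \<and> card \<B> = k \<and> F \<subseteq> \<Union>\<B> \<and>
      (\<forall>B\<in>\<B>. \<exists>l. open_box_with_sides B l \<and> (\<forall>i. l $ i \<le> \<delta> $ i))"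
  have "?P (card \<B>)" using assms by blast
  then have "?P (cover_number F \<delta>)" unfolding cover_number_def by (rule LeastI)
  then show ?thesis using that by blast
qed

lemma prod_split_three:
  fixes f :: "'n::finite \<Rightarrow> real"
  assumes "i \<noteq> j" "i \<noteq> l" "j \<noteq> l"
  shows "prod f UNIV = f i * f j * f l * prod f (UNIV - {i, j, l})"
proof -
  have U: "UNIV = insert i (insert j (insert l (UNIV - {i, j, l})))" by auto
  show ?thesis by (subst U) (use assms in \<open>simp add: mult.assoc\<close>)
qed

text \<open>
  Here \<open>i\<close>, \<open>j\<close>, \<open>l\<close> are the first, second and last index.

  A patch with tangential sides \<open>w\<^sub>1, \<delta>\<^sub>2, \<delta>\<^sub>3, \<dots>\<close>, of which \<open>w\<^sub>1\<close> is the longest, has thickness of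
  order \<open>w\<^sub>1\<^sup>2\<close> and hence is cut into about \<open>1 + w\<^sub>1\<^sup>2 / \<delta>\<^sub>l\<close> slices. For
  \<open>\<delta>\<^sub>2 \<le> w\<^sub>1 \<le> \<delta>\<^sub>1\<close> the total number is smallest, up to a constant, if \<open>w\<^sub>1\<close> is as close as possible to
  \<open>\<surd>\<delta>\<^sub>l\<close>. The three positions of \<open>\<surd>\<delta>\<^sub>l\<close> relative to \<open>\<delta>\<^sub>2 \<le> \<delta>\<^sub>1\<close> give the bounds \<open>T0\<close>, \<open>T1\<close>, \<open>T2\<close>.

  The lower bounds use a shell of thickness \<open>\<eta> = \<delta>\<^sub>l\<close>. The factor \<open>\<delta>\<^sub>l\<close> of the volume of the shell
  cancels against the side \<open>\<delta>\<^sub>l\<close> of the box, and the three bounds for the area of the section in the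
  first two coordinates remain.
\<close>
lemma cover_number_sphere_bounds:
  fixes \<delta> :: "real ^ 'n::{finite,linorder}"
  assumes \<delta>: "\<delta> \<in> admissible_scales"
    and ijl: "i \<noteq> j" "i \<noteq> l" "j \<noteq> l" and order: "\<And>k. i \<le> k" "\<forall>k. k \<noteq> i \<longrightarrow> j \<le> k" "\<And>k. k \<le> l"
  defines "R \<equiv> \<Prod>k\<in>UNIV - {i, j, l}. \<delta> $ k"
  defines "c \<equiv> unit_ball_vol CARD('n) / (12 * 3 ^ CARD('n))"
    and "C \<equiv> 20 ^ CARD('n) * (1 + 2 * real CARD('n))"
    and "T0 \<equiv> 1 / (\<delta> $ i * \<delta> $ j * R)"
    and "T1 \<equiv> 1 / (\<delta> $ j * sqrt (\<delta> $ l) * R)"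
    and "T2 \<equiv> 1 / (\<delta> $ l * R)"
  shows "c * T0 \<le> real (cover_number (sphere 0 1) \<delta>)"
    and "c * T1 \<le> real (cover_number (sphere 0 1) \<delta>)"
    and "c * T2 \<le> real (cover_number (sphere 0 1) \<delta>)"
    and "real (cover_number (sphere 0 1) \<delta>) \<le> C * max T0 (max T1 T2)"
proof -
  let ?N = "cover_number (sphere 0 1) \<delta>"
  let ?n = "CARD('n)"
  have pos: "0 < \<delta> $ k" and lt1: "\<delta> $ k < 1" and mono: "k \<le> k' \<Longrightarrow> \<delta> $ k' \<le> \<delta> $ k" for k k'
    using \<delta> by (auto simp: admissible_scales_def)
  have R: "R > 0" unfolding R_def using pos by (intro prod_pos) auto
  have T: "T0 > 0" "T1 > 0" "T2 > 0" using R pos by (auto simp: T0_def T1_def T2_def)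
  define s where "s = sqrt (\<delta> $ l)"
  have s: "s > 0" "s * s = \<delta> $ l" using pos[of l] by (auto simp: s_def)
  define w1 where "w1 = min (\<delta> $ i) (max (\<delta> $ j) s)"
  define w :: "real ^ 'n::{finite,linorder}" where "w = (\<chi> k. if k = i then w1 else \<delta> $ k)"
  have ji: "\<delta> $ j \<le> \<delta> $ i" by (rule mono[OF order(1)])
  have w1: "0 < w1" "w1 \<le> \<delta> $ i" "\<delta> $ j \<le> w1" using pos ji s by (auto simp: w1_def)
  have w_le: "w $ k \<le> w1" for k
    using w1 mono[of j k] order(2) by (auto simp: w_def intro: order.trans)
  have w_pos: "0 < w $ k" for k using w1 pos by (simp add: w_def)
  have w_mono: "\<forall>k k'. k \<le> k' \<longrightarrow> w $ k' \<le> w $ k"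
  proof (intro allI impI)
    fix k k' :: 'n assume "k \<le> k'"
    then show "w $ k' \<le> w $ k" using w_le[of k'] mono[of k k'] order(1)[of k] by (auto simp: w_def)
  qed
  have w_\<delta>: "w $ k \<le> \<delta> $ k" for k using w1 by (simp add: w_def)
  have w_1: "w $ k \<le> 1" for k using w_\<delta>[of k] lt1[of k] by simp
  have n2: "?n \<ge> 2"
    using card_mono[of UNIV "{i, j}"] ijl by simp
  obtain \<B> where \<B>: "finite \<B>" "sphere 0 1 \<subseteq> \<Union>\<B>"
      "\<And>B. B \<in> \<B> \<Longrightarrow> \<exists>l. open_box_with_sides B l \<and> (\<forall>k. l $ k \<le> \<delta> $ k)"
    and card\<B>: "real (card \<B>) \<le> (\<Prod>k\<in>UNIV - {l}. 20 / w $ k) * (1 + 2 * (\<Sum>k\<in>UNIV - {l}. (w $ k)\<^sup>2) / w $ l)"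
    using sphere_box_cover[of w \<delta> l, OF w_pos w_mono w_\<delta> w_1 order(3) n2] by blast
  have wl: "w $ l = \<delta> $ l" using ijl by (simp add: w_def)
  have "(\<Sum>k\<in>UNIV - {l}. (w $ k)\<^sup>2) \<le> (\<Sum>k\<in>UNIV - {l}. w1\<^sup>2)"
    using w_le w_pos by (intro sum_mono power_mono) (auto intro: less_imp_le)
  also have "\<dots> \<le> real ?n * w1\<^sup>2" by (simp add: card_Diff_singleton mult_right_mono)
  finally have sumw: "(\<Sum>k\<in>UNIV - {l}. (w $ k)\<^sup>2) \<le> real ?n * w1\<^sup>2" .
  have "UNIV - {l} = insert i (insert j (UNIV - {i, j, l}))" using ijl by auto
  then have "(\<Prod>k\<in>UNIV - {l}. 20 / w $ k) = 20 / w1 * (20 / \<delta> $ j) * (\<Prod>k\<in>UNIV - {i, j, l}. 20 / w $ k)"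
    using ijl by (simp add: w_def)
  also have "(\<Prod>k\<in>UNIV - {i, j, l}. 20 / w $ k) = (\<Prod>k\<in>UNIV - {i, j, l}. 20 / \<delta> $ k)"
    by (intro prod.cong) (auto simp: w_def)
  also have "\<dots> = 20 ^ card (UNIV - {i, j, l}) / R" by (simp add: prod_dividef R_def)
  finally have "(\<Prod>k\<in>UNIV - {l}. 20 / w $ k) = 20 ^ (2 + card (UNIV - {i, j, l})) / (w1 * \<delta> $ j * R)"
    by simp
  also have "\<dots> \<le> 20 ^ ?n / (w1 * \<delta> $ j * R)"
  proof (rule divide_right_mono)
    have "card {i, j} + card (UNIV - {i, j, l}) = card ({i, j} \<union> (UNIV - {i, j, l}))"
      by (rule card_Un_disjoint[symmetric]) auto
    also have "\<dots> \<le> ?n" by (rule card_mono) auto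
    finally show "(20::real) ^ (2 + card (UNIV - {i, j, l})) \<le> 20 ^ ?n"
      using ijl by (intro power_increasing) auto
    show "0 \<le> w1 * \<delta> $ j * R" using w1 pos[of j] R by simp
  qed
  finally have prodw: "(\<Prod>k\<in>UNIV - {l}. 20 / w $ k) \<le> 20 ^ ?n / (w1 * \<delta> $ j * R)" .
  have N1: "real ?N \<le> 20 ^ ?n / (w1 * \<delta> $ j * R) * (1 + 2 * (real ?n * w1\<^sup>2) / \<delta> $ l)"
  proof -
    have "real ?N \<le> real (card \<B>)" using cover_number_le[OF \<B>] by simp
    also have "\<dots> \<le> (\<Prod>k\<in>UNIV - {l}. 20 / w $ k) * (1 + 2 * (\<Sum>k\<in>UNIV - {l}. (w $ k)\<^sup>2) / w $ l)"
      by (rule card\<B>)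
    also have "\<dots> \<le> 20 ^ ?n / (w1 * \<delta> $ j * R) * (1 + 2 * (real ?n * w1\<^sup>2) / \<delta> $ l)"
    proof (rule mult_mono[OF prodw])
      show "1 + 2 * (\<Sum>k\<in>UNIV - {l}. (w $ k)\<^sup>2) / w $ l \<le> 1 + 2 * (real ?n * w1\<^sup>2) / \<delta> $ l"
        unfolding wl using sumw pos[of l] by (intro add_left_mono divide_right_mono) auto
      show "0 \<le> 1 + 2 * (\<Sum>k\<in>UNIV - {l}. (w $ k)\<^sup>2) / w $ l"
        using w_pos[of l] by (intro add_nonneg_nonneg divide_nonneg_pos mult_nonneg_nonneg sum_nonneg) auto
      show "0 \<le> 20 ^ ?n / (w1 * \<delta> $ j * R)" using w1 pos[of j] R by simp
    qed
    finally show ?thesis .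
  qed
  have fin: "real ?N \<le> C * X" if X: "1 / (w1 * \<delta> $ j * R) * Y \<le> X" and Y: "1 \<le> Y" "w1\<^sup>2 / \<delta> $ l \<le> Y" for X Y
  proof -
    have "1 + 2 * (real ?n * w1\<^sup>2) / \<delta> $ l = 1 + 2 * real ?n * (w1\<^sup>2 / \<delta> $ l)" by simp
    also have "\<dots> \<le> Y + 2 * real ?n * Y" using Y by (intro add_mono mult_left_mono) auto
    finally have "1 + 2 * (real ?n * w1\<^sup>2) / \<delta> $ l \<le> (1 + 2 * real ?n) * Y" by (simp add: algebra_simps)
    then have "20 ^ ?n / (w1 * \<delta> $ j * R) * (1 + 2 * (real ?n * w1\<^sup>2) / \<delta> $ l) \<le>
       20 ^ ?n / (w1 * \<delta> $ j * R) * ((1 + 2 * real ?n) * Y)"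
      using w1 pos[of j] R by (intro mult_left_mono) auto
    also have "\<dots> = C * (1 / (w1 * \<delta> $ j * R) * Y)" by (simp add: C_def)
    also have "\<dots> \<le> C * X" using X by (intro mult_left_mono) (auto simp: C_def)
    finally show ?thesis using N1 by simp
  qed
  have C0: "C \<ge> 0" by (simp add: C_def)
  consider "\<delta> $ i \<le> s" | "\<delta> $ j \<le> s" "s < \<delta> $ i" | "s < \<delta> $ j" by linarith
  then show "real ?N \<le> C * max T0 (max T1 T2)"
  proof cases
    case 1
    then have w1_eq: "w1 = \<delta> $ i" using ji by (simp add: w1_def)
    have "w1\<^sup>2 \<le> s\<^sup>2" using 1 w1 by (intro power_mono) (auto simp: w1_eq)
    then have "w1\<^sup>2 / \<delta> $ l \<le> 1" using s pos[of l] by (simp add: power2_eq_square)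
    then have "real ?N \<le> C * T0" by (intro fin[of 1]) (auto simp: w1_eq T0_def)
    also have "\<dots> \<le> C * max T0 (max T1 T2)" using C0 by (intro mult_left_mono) auto
    finally show ?thesis .
  next
    case 2
    then have w1_eq: "w1 = s" by (simp add: w1_def)
    have "w1\<^sup>2 / \<delta> $ l \<le> 1" using s pos[of l] by (simp add: w1_eq power2_eq_square)
    then have "real ?N \<le> C * T1" by (intro fin[of 1]) (auto simp: w1_eq T1_def s_def mult.commute)
    also have "\<dots> \<le> C * max T0 (max T1 T2)" using C0 by (intro mult_left_mono) auto
    finally show ?thesis .
  next
    case 3
    then have w1_eq: "w1 = \<delta> $ j" using ji by (simp add: w1_def)
    have "s * s \<le> \<delta> $ j * \<delta> $ j" using 3 s by (intro mult_mono) auto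
    then have "1 \<le> (\<delta> $ j)\<^sup>2 / \<delta> $ l" using s pos[of l] by (simp add: power2_eq_square)
    then have "real ?N \<le> C * T2"
      using pos[of j] by (intro fin[of "(\<delta> $ j)\<^sup>2 / \<delta> $ l"]) (auto simp: w1_eq T2_def power2_eq_square mult.commute[of R])
    also have "\<dots> \<le> C * max T0 (max T1 T2)" using C0 by (intro mult_left_mono) auto
    finally show ?thesis .
  qed
  obtain \<B>' where \<B>': "finite \<B>'" "card \<B>' = ?N" "sphere 0 1 \<subseteq> \<Union>\<B>'"
    "\<And>B. B \<in> \<B>' \<Longrightarrow> \<exists>l. open_box_with_sides B l \<and> (\<forall>k. l $ k \<le> \<delta> $ k)"
    using cover_number_attained[OF \<B>] by metis
  let ?V = "unit_ball_vol ?n"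
  let ?min = "min (3 * \<delta> $ i * (3 * \<delta> $ j)) (min (2 * sqrt (3 * \<delta> $ l) * (3 * \<delta> $ j)) (pi * (3 * \<delta> $ l)))"
  have V: "?V > 0" by simp
  have "UNIV - {i, j} = insert l (UNIV - {i, j, l})" using ijl by auto
  then have "(\<Prod>k\<in>UNIV - {i, j}. 3 * \<delta> $ k) = 3 ^ Suc (card (UNIV - {i, j, l})) * (\<delta> $ l * R)"
    by (simp add: prod.distrib R_def)
  also have "\<dots> \<le> 3 ^ ?n * (\<delta> $ l * R)"
  proof (rule mult_right_mono)
    have "card {l} + card (UNIV - {i, j, l}) = card ({l} \<union> (UNIV - {i, j, l}))"
      by (rule card_Un_disjoint[symmetric]) auto
    also have "\<dots> \<le> ?n" by (rule card_mono) auto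
    finally show "(3::real) ^ Suc (card (UNIV - {i, j, l})) \<le> 3 ^ ?n"
      by (intro power_increasing) auto
  qed (use pos[of l] R in simp)
  finally have prod3: "(\<Prod>k\<in>UNIV - {i, j}. 3 * \<delta> $ k) \<le> 3 ^ ?n * (\<delta> $ l * R)" .
  \<comment> \<open>the constant 12 exceeds \<open>3 \<cdot> 3\<close>, \<open>2 \<surd>3 \<cdot> 3\<close> and \<open>3 \<pi>\<close>, the constants of the three entries of the minimum\<close>
  have low: "c * (1 / (K * R)) \<le> real ?N" if K: "K > 0" "?min \<le> 12 * K" for K
  proof -
    have "?V * \<delta> $ l \<le> real (card \<B>') * (?min * (\<Prod>k\<in>UNIV - {i, j}. 3 * \<delta> $ k))"
      using pos lt1[of l] order(3) by (intro card_sphere_cover_ge[OF \<B>'(1,3,4) ijl(1)]) (auto intro: mono less_imp_le)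
    also have "\<dots> \<le> real (card \<B>') * (12 * K * (3 ^ ?n * (\<delta> $ l * R)))"
      using K prod3 pos by (intro mult_left_mono mult_mono prod_nonneg) (auto intro: less_imp_le)
    finally have "\<delta> $ l * ?V \<le> \<delta> $ l * (real ?N * (12 * K * (3 ^ ?n * R)))"
      by (simp add: \<B>'(2) algebra_simps)
    then have "?V \<le> real ?N * (12 * K * (3 ^ ?n * R))" using pos[of l] by simp
    then show ?thesis using K R by (simp add: c_def field_simps)
  qed
  show "c * T0 \<le> real ?N"
  proof -
    have "?min \<le> 12 * (\<delta> $ i * \<delta> $ j)" using pos[of i] pos[of j] by (intro min.coboundedI1) simp
    then show ?thesis using low[of "\<delta> $ i * \<delta> $ j"] pos[of i] pos[of j] by (simp add: T0_def)
  qed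
  show "c * T1 \<le> real ?N"
  proof -
    have "sqrt 3 \<le> 2" by (rule real_le_lsqrt) auto
    then have "sqrt 3 * (6 * (\<delta> $ j * s)) \<le> 2 * (6 * (\<delta> $ j * s))"
      using pos[of j] s by (intro mult_right_mono) auto
    then have "?min \<le> 12 * (\<delta> $ j * sqrt (\<delta> $ l))"
      by (intro min.coboundedI2 min.coboundedI1) (simp add: real_sqrt_mult s_def algebra_simps)
    then show ?thesis using low[of "\<delta> $ j * sqrt (\<delta> $ l)"] pos[of j] pos[of l] by (simp add: T1_def)
  qed
  show "c * T2 \<le> real ?N"
  proof -
    have "pi * (3 * \<delta> $ l) \<le> 12 * \<delta> $ l" using pi_less_4 pos[of l] by simp
    then have "?min \<le> 12 * \<delta> $ l" by (intro min.coboundedI2)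
    then show ?thesis using low[of "\<delta> $ l"] pos[of l] by (simp add: T2_def)
  qed
qed

lemma inner_vec_of:
  fixes a :: "real ^ 'n::{finite,linorder}"
  shows "a \<bullet> vec_of f = (\<Sum>k = 1..CARD('n). coord a k * f k)"
proof -
  have "a \<bullet> vec_of f = (\<Sum>i\<in>(UNIV::'n set). coord a (pos i) * f (pos i))"
    by (simp add: inner_vec_def vec_of_def)
  also have "\<dots> = (\<Sum>k = 1..CARD('n). coord a k * f k)" by (rule sum_pos)
  finally show ?thesis .
qed

lemma tail_sum_vec_of:
  assumes "k \<ge> 1"
  shows "tail_sum k (vec_of f :: real ^ 'n::{finite,linorder}) = (\<Sum>i = k..CARD('n). f i)"
  unfolding tail_sum_def using assms by (intro sum.cong refl coord_vec_of) auto

text \<open>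
  The shape in which the monomials \<open>\<delta>\<^sup>-\<^sup>p\<close> occur in the bounds for the sphere: the three vectors
  \<open>p\<close> differ only in the first, second and last entry.
\<close>
lemma exp_inner_eq_monomial:
  fixes a p :: "real ^ 'n::{finite,linorder}"
  assumes ijl: "i \<noteq> j" "i \<noteq> l" "j \<noteq> l" and p: "\<And>k. k \<notin> {i, j, l} \<Longrightarrow> p $ k = 1"
  shows "exp (a \<bullet> p) = 1 / (exp (- (a $ i * p $ i)) * exp (- (a $ j * p $ j)) * exp (- (a $ l * p $ l))
     * (\<Prod>k\<in>UNIV - {i, j, l}. exp_scale 1 a $ k))"
proof -
  have "exp (a \<bullet> p) = (\<Prod>k\<in>UNIV. exp (a $ k * p $ k))" by (simp add: inner_vec_def exp_sum)
  also have "\<dots> = exp (a $ i * p $ i) * exp (a $ j * p $ j) * exp (a $ l * p $ l) * (\<Prod>k\<in>UNIV - {i, j, l}. exp (a $ k * p $ k))"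
    by (rule prod_split_three[OF ijl])
  also have "(\<Prod>k\<in>UNIV - {i, j, l}. exp (a $ k * p $ k)) = (\<Prod>k\<in>UNIV - {i, j, l}. 1 / exp_scale 1 a $ k)"
    using p by (intro prod.cong) (auto simp: exp_scale_def exp_minus divide_inverse)
  also have "\<dots> = 1 / (\<Prod>k\<in>UNIV - {i, j, l}. exp_scale 1 a $ k)"
    by (simp add: prod_dividef)
  finally show ?thesis by (simp add: exp_minus field_simps)
qed

lemma sphere_cover_comparable:
  fixes p0 p1 p2 :: "real ^ 'n::{finite,linorder}"
  assumes m: "m \<ge> 2" and n: "CARD('n) = m + 1"
    and p0: "p0 = vec_of (\<lambda>i. if i \<le> m then 1 else 0)"
    and p1: "p1 = vec_of (\<lambda>i. if i = 1 then 0 else if i \<le> m then 1 else 1 / 2)"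
    and p2: "p2 = vec_of (\<lambda>i. if i \<le> 2 then 0 else 1)"
  shows "cover_comparable (sphere 0 1) {p0, p1, p2}"
proof -
  obtain i :: 'n where i: "pos i = 1" using pos_surj[where 'n = 'n, of 1] n by auto
  have "2 \<in> {1..CARD('n)}" "m + 1 \<in> {1..CARD('n)}" using m n by auto
  then obtain j l :: 'n where j: "pos j = 2" and l: "pos l = m + 1" by (metis pos_surj)
  have ijl: "i \<noteq> j" "i \<noteq> l" "j \<noteq> l" using i j l m by auto
  have ord: "i \<le> k" "k \<le> l" "k \<noteq> i \<longrightarrow> j \<le> k" for k
  proof -
    have k: "1 \<le> pos k" "pos k \<le> m + 1" using pos_ge_1[of k] pos_le_card[of k] n by auto
    show "i \<le> k" "k \<le> l" using k i l by (simp_all flip: pos_le_iff)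
    show "k \<noteq> i \<longrightarrow> j \<le> k"
    proof
      assume that: "k \<noteq> i"
      have "pos k \<noteq> 1" using that i pos_eq_iff[of k i] by simp
      then show "j \<le> k" using k j by (simp flip: pos_le_iff)
    qed
  qed
  have ord2: "\<forall>k. k \<noteq> i \<longrightarrow> j \<le> k" using ord(3) by blast
  have mid: "3 \<le> pos k \<and> pos k \<le> m" if "k \<notin> {i, j, l}" for k
  proof -
    have "pos k \<noteq> pos i" "pos k \<noteq> pos j" "pos k \<noteq> pos l" using that by (auto simp: pos_eq_iff)
    then show ?thesis using i j l pos_ge_1[of k] pos_le_card[of k] n by auto
  qed
  have one: "p0 $ k = 1" "p1 $ k = 1" "p2 $ k = 1" if "k \<notin> {i, j, l}" for k
    using mid[OF that] by (auto simp: p0 p1 p2 vec_of_def)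
  have vals: "p0 $ i = 1" "p0 $ j = 1" "p0 $ l = 0" "p1 $ i = 0" "p1 $ j = 1" "p1 $ l = 1 / 2"
    "p2 $ i = 0" "p2 $ j = 0" "p2 $ l = 1"
    using i j l m by (auto simp: p0 p1 p2 vec_of_def)
  define c where "c = unit_ball_vol CARD('n) / (12 * 3 ^ CARD('n))"
  define C where "C = 20 ^ CARD('n) * (1 + 2 * real CARD('n))"
  have "c * exp (support_max {p0, p1, p2} a) \<le> real (cover_number (sphere 0 1) (exp_scale 1 a)) \<and>
       real (cover_number (sphere 0 1) (exp_scale 1 a)) \<le> C * exp (support_max {p0, p1, p2} a)"
    if a: "a \<in> rate_cone" for a
  proof -
    let ?\<delta> = "exp_scale 1 a"
    have sq: "sqrt (?\<delta> $ l) = exp (- (a $ l * p1 $ l))"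
      by (rule real_sqrt_unique) (simp_all add: exp_scale_def vals flip: exp_double)
    have T0: "exp (a \<bullet> p0) = 1 / (?\<delta> $ i * ?\<delta> $ j * (\<Prod>k\<in>UNIV - {i, j, l}. ?\<delta> $ k))"
      using exp_inner_eq_monomial[OF ijl, of p0 a] one by (simp add: vals exp_scale_def)
    have T1: "exp (a \<bullet> p1) = 1 / (?\<delta> $ j * sqrt (?\<delta> $ l) * (\<Prod>k\<in>UNIV - {i, j, l}. ?\<delta> $ k))"
      unfolding sq using exp_inner_eq_monomial[OF ijl, of p1 a] one by (simp add: vals exp_scale_def)
    have T2: "exp (a \<bullet> p2) = 1 / (?\<delta> $ l * (\<Prod>k\<in>UNIV - {i, j, l}. ?\<delta> $ k))"
      using exp_inner_eq_monomial[OF ijl, of p2 a] one by (simp add: vals exp_scale_def)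
    note bounds = cover_number_sphere_bounds[OF exp_scale_admissible[OF a] ijl ord(1) ord2 ord(2),
        folded T0 T1 T2 c_def C_def]
    obtain p where p: "p \<in> {p0, p1, p2}" "support_max {p0, p1, p2} a = a \<bullet> p"
      using support_max_attained[of "{p0, p1, p2}" a] by blast
    have "exp (a \<bullet> q) \<le> exp (support_max {p0, p1, p2} a)" if "q \<in> {p0, p1, p2}" for q
      using inner_le_support_max[OF _ that] by simp
    then have "max (exp (a \<bullet> p0)) (max (exp (a \<bullet> p1)) (exp (a \<bullet> p2))) \<le> exp (support_max {p0, p1, p2} a)"
      by simp
    then have "C * max (exp (a \<bullet> p0)) (max (exp (a \<bullet> p1)) (exp (a \<bullet> p2))) \<le> C * exp (support_max {p0, p1, p2} a)"
      by (rule mult_left_mono) (simp add: C_def)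
    then show ?thesis using bounds p by auto
  qed
  moreover have "c > 0" "C > 0" by (auto simp: c_def C_def add_pos_nonneg)
  ultimately show ?thesis unfolding cover_comparable_def by blast
qed

theorem theorem4p13:
  fixes m :: nat
    and S :: "(real ^ 'n::{finite,linorder}) set"
    and p0 p1 p2 :: "real ^ 'n::{finite,linorder}"
    and P :: "(real ^ 'n::{finite,linorder}) set"
  assumes "m \<ge> 2" and "CARD('n) = m + 1"
    and "S = sphere 0 1"
    and "p0 = vec_of (\<lambda>i. if i \<le> m then 1 else 0)"
    and "p1 = vec_of (\<lambda>i. if i = 1 then 0 else if i \<le> m then 1 else 1 / 2)"
    and "p2 = vec_of (\<lambda>i. if i \<le> 2 then 0 else 1)"
    and "P = convex hull {p0, p1, p2}"
  shows "uniformly_profile_regular S \<and>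
    (\<forall>a\<in>rate_cone. profile S a =
      Max {\<Sum>i = 1..m. coord a i,
           1 / 2 * coord a (m + 1) + (\<Sum>i = 2..m. coord a i),
           coord a (m + 1) + (\<Sum>i = 3..m. coord a i)}) \<and>
    lower_print S =
      {\<alpha> \<in> orthant. \<exists>p\<in>P. \<forall>k\<in>{1..m + 1}. tail_sum k \<alpha> \<le> tail_sum k p} \<and>
    upper_print S =
      {\<alpha> \<in> orthant. tail_sum 1 \<alpha> \<le> real m} \<union>
      {\<alpha> \<in> orthant. tail_sum 2 \<alpha> < real m - 1 / 2} \<union>
      (\<Union>k\<in>{3..m + 1}. {\<alpha> \<in> orthant. tail_sum k \<alpha> < real m - real k + 2})"
proof (intro conjI ballI)
  note m = assms(1) and n = assms(2) and p = assms(4-6)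
  have comp: "cover_comparable S {p0, p1, p2}"
    unfolding assms(3) by (rule sphere_cover_comparable[OF m n p])
  show "uniformly_profile_regular S" by (rule cover_comparable_uniformly_profile_regular[OF comp])
  show "lower_print S = {\<alpha> \<in> orthant. \<exists>p\<in>P. \<forall>k\<in>{1..m + 1}. tail_sum k \<alpha> \<le> tail_sum k p}"
    unfolding cover_comparable_lower_print[OF comp] assms(7) n ..
  show "profile S a = Max {\<Sum>i = 1..m. coord a i,
           1 / 2 * coord a (m + 1) + (\<Sum>i = 2..m. coord a i),
           coord a (m + 1) + (\<Sum>i = 3..m. coord a i)}"
    if a: "a \<in> rate_cone" for a
  proof -
    have "a \<bullet> p0 = (\<Sum>i = 1..m. coord a i)"
      unfolding p inner_vec_of n by simp
    moreover have "a \<bullet> p1 = 1 / 2 * coord a (m + 1) + (\<Sum>i = 2..m. coord a i)"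
    proof -
      have "(\<Sum>i = 1..m. coord a i * (if i = 1 then 0 else if i \<le> m then 1 else 1 / 2)) = (\<Sum>i = 2..m. coord a i)"
        by (rule sum.mono_neutral_cong_right) auto
      then show ?thesis unfolding p inner_vec_of n using m by simp
    qed
    moreover have "a \<bullet> p2 = coord a (m + 1) + (\<Sum>i = 3..m. coord a i)"
    proof -
      have "(\<Sum>i = 1..m. coord a i * (if i \<le> 2 then 0 else 1)) = (\<Sum>i = 3..m. coord a i)"
        by (rule sum.mono_neutral_cong_right) auto
      then show ?thesis unfolding p inner_vec_of n using m by simp
    qed
    ultimately show ?thesis
      unfolding cover_comparable_profile_eq[OF comp a] support_max_def by simp
  qed
  have t0: "tail_sum k p0 = real m + 1 - real k" if "k \<in> {1..m + 1}" for k
  proof -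
    have "(\<Sum>i = k..m. if i \<le> m then 1 else 0 :: real) = (\<Sum>i = k..m. 1)" by (rule sum.cong) auto
    then show ?thesis using that by (simp add: p tail_sum_vec_of n of_nat_diff)
  qed
  have t1: "tail_sum k p1 = real m + 3 / 2 - real k" if "k \<in> {2..m + 1}" for k
  proof -
    have "(\<Sum>i = k..m. if i = Suc 0 then 0 else if i \<le> m then 1 else 1 / 2 :: real) = (\<Sum>i = k..m. 1)"
      using that by (intro sum.cong) auto
    then show ?thesis using that m by (simp add: p tail_sum_vec_of n of_nat_diff)
  qed
  have t2: "tail_sum k p2 = real m + 2 - real k" if "k \<in> {3..m + 1}" for k
  proof -
    have "(\<Sum>i = k..m. if i \<le> 2 then 0 else 1 :: real) = (\<Sum>i = k..m. 1)"
      using that by (intro sum.cong) auto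
    then show ?thesis using that m by (simp add: p tail_sum_vec_of n of_nat_diff)
  qed
  have first: "tail_sum k x = coord x k + tail_sum (Suc k) x" if "k \<in> {1..m + 1}" for k and x :: "real ^ 'n::{finite,linorder}"
    unfolding tail_sum_def n using that by (intro sum.atLeast_Suc_atMost) auto
  have t1_1: "tail_sum 1 p1 = real m - 1 / 2"
    using first[of 1 p1] t1[of 2] m by (simp add: p coord_vec_of n numeral_2_eq_2)
  have t2_2: "tail_sum 2 p2 = real m - 1"
    using first[of 2 p2] t2[of 3] m by (simp add: p coord_vec_of n numeral_3_eq_3)
  have t2_1: "tail_sum 1 p2 = real m - 1"
    using first[of 1 p2] t2_2 m by (simp add: p coord_vec_of n numeral_2_eq_2)
  have split: "(\<exists>k\<in>{2..m + 1}. Q k) \<longleftrightarrow> Q 2 \<or> (\<exists>k\<in>{3..m + 1}. Q k)" for Q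
  proof -
    have "{2..m + 1} = insert 2 {3..m + 1}" using m by auto
    then show ?thesis by simp
  qed
  show "upper_print S =
      {\<alpha> \<in> orthant. tail_sum 1 \<alpha> \<le> real m} \<union>
      {\<alpha> \<in> orthant. tail_sum 2 \<alpha> < real m - 1 / 2} \<union>
      (\<Union>k\<in>{3..m + 1}. {\<alpha> \<in> orthant. tail_sum k \<alpha> < real m - real k + 2})"
  proof -
    have "(\<exists>p\<in>{p0, p1, p2}. tail_sum 1 \<alpha> \<le> tail_sum 1 p \<or> (\<exists>k\<in>{2..m + 1}. tail_sum k \<alpha> < tail_sum k p)) \<longleftrightarrow>
      tail_sum 1 \<alpha> \<le> real m \<or> tail_sum 2 \<alpha> < real m - 1 / 2 \<or>
      (\<exists>k\<in>{3..m + 1}. tail_sum k \<alpha> < real m - real k + 2)" (is "?L \<longleftrightarrow> ?R") for \<alpha>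
    proof -
      have "?L \<longleftrightarrow> (tail_sum 1 \<alpha> \<le> tail_sum 1 p0 \<or> tail_sum 1 \<alpha> \<le> tail_sum 1 p1 \<or> tail_sum 1 \<alpha> \<le> tail_sum 1 p2) \<or>
         (tail_sum 2 \<alpha> < tail_sum 2 p0 \<or> tail_sum 2 \<alpha> < tail_sum 2 p1 \<or> tail_sum 2 \<alpha> < tail_sum 2 p2) \<or>
         (\<exists>k\<in>{3..m + 1}. tail_sum k \<alpha> < tail_sum k p0 \<or> tail_sum k \<alpha> < tail_sum k p1 \<or> tail_sum k \<alpha> < tail_sum k p2)"
        unfolding split by blast
      also have "(tail_sum 1 \<alpha> \<le> tail_sum 1 p0 \<or> tail_sum 1 \<alpha> \<le> tail_sum 1 p1 \<or> tail_sum 1 \<alpha> \<le> tail_sum 1 p2)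
          \<longleftrightarrow> tail_sum 1 \<alpha> \<le> real m"
        unfolding t1_1 t2_1 using t0[of 1] by auto
      also have "(tail_sum 2 \<alpha> < tail_sum 2 p0 \<or> tail_sum 2 \<alpha> < tail_sum 2 p1 \<or> tail_sum 2 \<alpha> < tail_sum 2 p2)
          \<longleftrightarrow> tail_sum 2 \<alpha> < real m - 1 / 2"
        unfolding t2_2 using t0[of 2] t1[of 2] m by auto
      also have "(\<exists>k\<in>{3..m + 1}. tail_sum k \<alpha> < tail_sum k p0 \<or> tail_sum k \<alpha> < tail_sum k p1 \<or> tail_sum k \<alpha> < tail_sum k p2)
          \<longleftrightarrow> (\<exists>k\<in>{3..m + 1}. tail_sum k \<alpha> < real m - real k + 2)"
      proof (rule bex_cong[OF refl])
        fix k assume k: "k \<in> {3..m + 1}"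
        then show "(tail_sum k \<alpha> < tail_sum k p0 \<or> tail_sum k \<alpha> < tail_sum k p1 \<or> tail_sum k \<alpha> < tail_sum k p2)
          \<longleftrightarrow> tail_sum k \<alpha> < real m - real k + 2"
          using t0[of k] t1[of k] t2[of k] by auto
      qed
      finally show ?thesis .
    qed
    then show ?thesis unfolding cover_comparable_upper_print[OF comp] n by blast
  qed
qed

end
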